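(* Let $\mathbb{K}$ be a field, $S=\mathbb{K}[x_1,\ldots,x_n]$, and let $X$ and $Y$ be simplicial complexes on the vertex set $[n]=\{1,\ldots,n\}$. Then $$\mathrm{pd}(I_X\cap I_Y)\leq \mathrm{pd}(I_X)+\mathrm{pd}(I_Y)$$ and $$\mathrm{pd}(I_X+I_Y)\leq \mathrm{pd}(I_X)+\mathrm{pd}(I_Y)+1.$$
   Context: For a simplicial complex $X$ on $[n]$, $I_X$ is the ideal of $S$ generated by the monomials $\prod_{i\in A}x_i$ for all $A\subset[n]$ with $A\notin X$ (the Stanley–Reisner ideal). $\mathrm{pd}(M)$ denotes the projective dimension of a graded $S$-module $M$, i.e. the length of a minimal graded free resolution of $M$ over $S$. *)

theory Defs
  imports
    "HOL-Library.Poly_Mapping"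
    "HOL-Library.Set_Algebras"
    "HOL-Library.Extended_Nat"
    "Jordan_Normal_Form.Matrix_Kernel"
begin

text \<open>
  The polynomial ring over the field \<open>'k\<close> in the variables indexed by the finite type \<open>'n\<close>,
  which plays the role of \<open>[n]\<close>.
\<close>

type_synonym ('n, 'k) mpoly = "('n \<Rightarrow>\<^sub>0 nat) \<Rightarrow>\<^sub>0 'k"

definition var :: "'n \<Rightarrow> ('n::finite, 'k::field) mpoly" where
  "var i = Poly_Mapping.single (Poly_Mapping.single i 1) 1"

definition ideal_gen :: "('n::finite, 'k::field) mpoly set \<Rightarrow> ('n, 'k) mpoly set" where
  "ideal_gen = Modules.module.span (*)"

definition abstract_simplicial_complex :: "'n set set \<Rightarrow> bool" where
  "abstract_simplicial_complex X \<longleftrightarrow> (\<forall>A\<in>X. \<forall>B. B \<subseteq> A \<longrightarrow> B \<in> X)"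

definition stanley_reisner_ideal :: "'n set set \<Rightarrow> ('n::finite, 'k::field) mpoly set" where
  "stanley_reisner_ideal X = ideal_gen {\<Prod>i\<in>A. var i | A. A \<notin> X}"

text \<open>Homogeneity for the standard grading; the zero polynomial is homogeneous of every degree.\<close>

definition homogeneous :: "int \<Rightarrow> ('n::finite, 'k::field) mpoly \<Rightarrow> bool" where
  "homogeneous e p \<longleftrightarrow>
     (\<forall>t\<in>Poly_Mapping.keys p. int (\<Sum>i\<in>UNIV. Poly_Mapping.lookup t i) = e)"

text \<open>
  A graded free resolution of an ideal \<open>I\<close>, viewed as a graded \<open>S\<close>-module:
  \<open>\<dots> \<rightarrow> F 2 \<rightarrow> F 1 \<rightarrow> F 0 \<rightarrow> I \<rightarrow> 0\<close> is exact, where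
  \<open>F i\<close> is the direct sum of the \<open>S(- (d i ! j))\<close> for \<open>j < length (d i)\<close>,
  the matrix \<open>\<phi> i\<close> is the differential from \<open>F (i + 1)\<close> to \<open>F i\<close>, and the augmentation
  from \<open>F 0\<close> onto \<open>I\<close> sends the \<open>j\<close>-th basis element to \<open>\<epsilon> $ j\<close>.
  All these maps are homogeneous of degree 0.
\<close>

definition graded_free_resolution ::
  "('n::finite, 'k::field) mpoly set \<Rightarrow> ('n, 'k) mpoly vec \<Rightarrow> (nat \<Rightarrow> int list)
    \<Rightarrow> (nat \<Rightarrow> ('n, 'k) mpoly mat) \<Rightarrow> bool" where
  "graded_free_resolution I \<epsilon> d \<phi> \<longleftrightarrow>
     \<epsilon> \<in> carrier_vec (length (d 0)) \<and>
     (\<forall>j < length (d 0). homogeneous (d 0 ! j) (\<epsilon> $ j)) \<and>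
     (\<forall>i. \<phi> i \<in> carrier_mat (length (d i)) (length (d (Suc i)))) \<and>
     (\<forall>i. \<forall>j < length (d i). \<forall>k < length (d (Suc i)).
        homogeneous (d (Suc i) ! k - d i ! j) (\<phi> i $$ (j, k))) \<and>
     (\<lambda>v. \<epsilon> \<bullet> v) ` carrier_vec (length (d 0)) = I \<and>
     {v \<in> carrier_vec (length (d 0)). \<epsilon> \<bullet> v = 0}
       = (\<lambda>w. \<phi> 0 *\<^sub>v w) ` carrier_vec (length (d 1)) \<and>
     (\<forall>i. mat_kernel (\<phi> i)
       = (\<lambda>w. \<phi> (Suc i) *\<^sub>v w) ` carrier_vec (length (d (Suc (Suc i)))))"

text \<open>
  Minimality: each differential maps into \<open>\<mm> F i\<close> for the irrelevant ideal \<open>\<mm>\<close>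
  generated by all the variables.
\<close>

definition minimal_graded_free_resolution ::
  "('n::finite, 'k::field) mpoly set \<Rightarrow> ('n, 'k) mpoly vec \<Rightarrow> (nat \<Rightarrow> int list)
    \<Rightarrow> (nat \<Rightarrow> ('n, 'k) mpoly mat) \<Rightarrow> bool" where
  "minimal_graded_free_resolution I \<epsilon> d \<phi> \<longleftrightarrow>
     graded_free_resolution I \<epsilon> d \<phi> \<and>
     (\<forall>i. \<forall>j < length (d i). \<forall>k < length (d (Suc i)).
        \<phi> i $$ (j, k) \<in> ideal_gen (range var))"

text \<open>
  The largest \<open>i\<close> with \<open>F i \<noteq> 0\<close>, or infinity if there is none because infinitely many
  \<open>F i\<close> are nonzero. The zero resolution has length 0, since \<open>Sup {} = 0\<close> in type \<open>enat\<close>.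
\<close>

definition resolution_length :: "(nat \<Rightarrow> int list) \<Rightarrow> enat" where
  "resolution_length d = (SUP i\<in>{i. d i \<noteq> []}. enat i)"

definition pd :: "('n::finite, 'k::field) mpoly set \<Rightarrow> enat" where
  "pd I = (THE l. \<exists>\<epsilon> d \<phi>. minimal_graded_free_resolution I \<epsilon> d \<phi> \<and> l = resolution_length d)"

end

theory Submission
  imports Defs
begin

text \<open>
  A complex of free modules with squarefree multidegrees is given by scalar matrices together with a
  label \<open>L b \<subseteq> [n]\<close> for each basis element \<open>b\<close>; its part in multidegree \<open>t\<close> is the strand spanned by
  the \<open>b\<close> with \<open>L b \<subseteq> supp t\<close>, so exactness can be checked on the finitely many strands over
  the field. Given such resolutions \<open>F\<close> of \<open>S/I_X\<close> and \<open>G\<close> of \<open>S/I_Y\<close>, the complex \<open>F \<otimes> G\<close> in which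
  \<open>b \<otimes> c\<close> receives the label \<open>L b \<union> L c\<close> has as strands the tensor products of the strands of \<open>F\<close> and
  \<open>G\<close>, and by Kuenneth it resolves \<open>S/(I_X + I_Y)\<close> (Herzog's generalization of the Taylor complex). The
  same construction on the truncations, which resolve \<open>I_X\<close> and \<open>I_Y\<close>, resolves \<open>I_X \<inter> I_Y\<close>. The
  length of a minimal resolution is a lower bound for the length of every free resolution, so both
  inequalities follow by counting degrees.
\<close>

section \<open>Free modules on a basis and their tensor products\<close>

text \<open>The usual tensor product over S of two resolutions adds multidegrees and has Tor(S/I_X,
  S/I_Y) as its homology, which is in general not zero in positive degrees. Taking unions of
  squarefree degrees instead repairs this: a union lies in A exactly when both sets do, so exactness
  becomes a question about tensor products over a field. The strand of a resolution of S/I_X at A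
  has homology K in degree 0 if A is a face and none otherwise; for the truncation the roles are
  exchanged. So both factors contribute for A in X \<inter> Y in the first case, and for A in
  neither complex in the second. The truncations lose one degree in each factor, whereas the full
  product loses only one in total when read as a resolution of the ideal. This is the origin of the
  extra 1 for the sum. As \<open>pd\<close> is a definite description over minimal resolutions, it
  has a usable value only once such a resolution exists and all of them have equal length. Existence
  is needed in squarefree form, so that the factors of the products have length exactly
  \<open>pd\<close>.\<close>

abbreviation keys :: "('a \<Rightarrow>\<^sub>0 'b::zero) \<Rightarrow> 'a set" where
  "keys \<equiv> Poly_Mapping.keys"

abbreviation lookup :: "('a \<Rightarrow>\<^sub>0 'b::zero) \<Rightarrow> 'a \<Rightarrow> 'b" where
  "lookup \<equiv> Poly_Mapping.lookup"

definition scl :: "'k::field \<Rightarrow> ('a \<Rightarrow>\<^sub>0 'k) \<Rightarrow> 'a \<Rightarrow>\<^sub>0 'k" where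
  "scl c = Poly_Mapping.map ((*) c)"

text \<open>The linear extension of \<open>f\<close> from the basis. Differentials, homotopies and
  projections are stored as values on basis elements throughout, and \<open>lin\<close> turns them
  into maps.\<close>

definition lin :: "('a \<Rightarrow> 'b \<Rightarrow>\<^sub>0 'k::field) \<Rightarrow> ('a \<Rightarrow>\<^sub>0 'k) \<Rightarrow> 'b \<Rightarrow>\<^sub>0 'k" where
  "lin f v = (\<Sum>a\<in>keys v. scl (lookup v a) (f a))"

abbreviation unit :: "'a \<Rightarrow> 'a \<Rightarrow>\<^sub>0 'k::field" where
  "unit a \<equiv> Poly_Mapping.single a 1"

lemma lookup_scl [simp]: "lookup (scl c v) x = c * lookup v x"
  by (simp add: scl_def Poly_Mapping.map.rep_eq when_def)

lemma scl_simps [simp]: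
  "scl c 0 = 0" "scl 0 v = 0" "scl 1 v = v" "scl c (v + w) = scl c v + scl c w"
  "scl c (- v) = - scl c v" "scl (- c) v = - scl c v"
  "scl c (v - w) = scl c v - scl c w" "scl c (scl d v) = scl (c * d) v"
  "scl c (Poly_Mapping.single a d) = Poly_Mapping.single a (c * d)"
  by (rule poly_mapping_eqI; simp add: lookup_add lookup_minus algebra_simps lookup_single when_def)+

lemma unit_neq_0 [simp]: "unit a \<noteq> 0"
  by (metis keys_zero keys_single empty_not_insert one_neq_zero)

lemma scl_add_left: "scl (c + d) v = scl c v + scl d v"
  by (rule poly_mapping_eqI) (simp add: lookup_add algebra_simps)

lemma scl_sum: "scl c (sum f S) = (\<Sum>a\<in>S. scl c (f a))"
  by (induction S rule: infinite_finite_induct) auto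

lemma keys_scl: "keys (scl c v) \<subseteq> keys v"
  by (auto simp: in_keys_iff)

lemma lin_superset:
  assumes "finite S" "keys v \<subseteq> S"
  shows "lin f v = (\<Sum>a\<in>S. scl (lookup v a) (f a))"
  unfolding lin_def using assms by (intro sum.mono_neutral_left) (auto simp: in_keys_iff)

lemma lin_zero [simp]: "lin f 0 = 0"
  by (simp add: lin_def)

lemma lin_add [simp]: "lin f (v + w) = lin f v + lin f w"
proof -
  let ?S = "keys v \<union> keys w"
  have "lin f (v + w) = (\<Sum>a\<in>?S. scl (lookup (v + w) a) (f a))"
    by (rule lin_superset) (auto simp: keys_add)
  moreover have "lin f v = (\<Sum>a\<in>?S. scl (lookup v a) (f a))"
    by (rule lin_superset) auto
  moreover have "lin f w = (\<Sum>a\<in>?S. scl (lookup w a) (f a))"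
    by (rule lin_superset) auto
  ultimately show ?thesis by (simp add: lookup_add scl_add_left sum.distrib)
qed

lemma lin_scl [simp]: "lin f (scl c v) = scl c (lin f v)"
proof -
  have "lin f (scl c v) = (\<Sum>a\<in>keys v. scl (lookup (scl c v) a) (f a))"
    by (rule lin_superset) (auto simp: keys_scl)
  then show ?thesis by (simp add: lin_def scl_sum)
qed

lemma lin_uminus [simp]: "lin f (- v) = - lin f v"
  using lin_scl[of f "-1" v] by simp

lemma lin_diff [simp]: "lin f (v - w) = lin f v - lin f w"
  using lin_add[of f v "- w"] by simp

lemma lin_sum: "lin f (sum g S) = (\<Sum>a\<in>S. lin f (g a))"
  by (induction S rule: infinite_finite_induct) auto

lemma lin_single [simp]: "lin f (Poly_Mapping.single a c) = scl c (f a)"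
  by (cases "c = 0") (simp_all add: lin_def)

lemma lin_cong: "(\<And>a. a \<in> keys v \<Longrightarrow> f a = g a) \<Longrightarrow> lin f v = lin g v"
  by (simp add: lin_def)

lemma lin_lin: "lin f (lin g v) = lin (\<lambda>a. lin f (g a)) v"
  by (simp add: lin_def[of g] lin_def[of _ v] lin_sum)

lemma lin_fun_add: "lin (\<lambda>a. f a + g a) v = lin f v + lin g v"
  by (simp add: lin_def sum.distrib)

lemma lin_fun_diff: "lin (\<lambda>a. f a - g a) v = lin f v - lin g v"
  by (simp add: lin_def sum_subtractf)

lemma lin_fun_uminus: "lin (\<lambda>a. - f a) v = - lin f v"
  by (simp add: lin_def sum_negf)

lemma lin_fun_scl: "lin (\<lambda>a. scl c (f a)) v = scl c (lin f v)"
  by (simp add: lin_def scl_sum mult.commute)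

lemma lin_fun_zero [simp]: "lin (\<lambda>a. 0) v = 0"
  by (simp add: lin_def)

lemma lin_unit [simp]: "lin unit v = v"
  by (rule poly_mapping_eqI)
     (simp add: lin_def lookup_sum lookup_single when_def in_keys_iff)

lemma lookup_lin:
  "lookup (lin f v) x
    = (\<Sum>a\<in>keys v. lookup v a * lookup (f a) x)"
  by (simp add: lin_def lookup_sum)

lemma keys_lin_subset:
  assumes "\<And>a. a \<in> keys v \<Longrightarrow> keys (f a) \<subseteq> S"
  shows "keys (lin f v) \<subseteq> S"
proof
  fix x assume "x \<in> keys (lin f v)"
  then have "(\<Sum>a\<in>keys v. lookup v a * lookup (f a) x) \<noteq> 0"
    by (simp add: in_keys_iff lookup_lin)
  then obtain a where "a \<in> keys v" "lookup (f a) x \<noteq> 0"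
    by (metis (mono_tags, lifting) mult_zero_right sum.neutral)
  then show "x \<in> S" using assms by (meson in_keys_iff subsetD)
qed

lemma lin_eq_0: "(\<And>a. a \<in> keys v \<Longrightarrow> f a = 0) \<Longrightarrow> lin f v = 0"
  by (simp add: lin_def)

definition tens :: "('a \<Rightarrow>\<^sub>0 'k::field) \<Rightarrow> ('b \<Rightarrow>\<^sub>0 'k) \<Rightarrow> ('a \<times> 'b) \<Rightarrow>\<^sub>0 'k" where
  "tens v w = lin (\<lambda>a. lin (\<lambda>b. unit (a, b)) w) v"

lemma tens_simps [simp]:
  "tens 0 w = 0" "tens v 0 = 0"
  "tens (v + v') w = tens v w + tens v' w" "tens v (w + w') = tens v w + tens v w'"
  "tens (v - v') w = tens v w - tens v' w" "tens v (w - w') = tens v w - tens v w'"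
  "tens (- v) w = - tens v w" "tens v (- w) = - tens v w"
  "tens (scl c v) w = scl c (tens v w)" "tens v (scl c w) = scl c (tens v w)"
  by (simp_all add: tens_def lin_fun_add lin_fun_diff lin_fun_uminus lin_fun_scl)

lemma tens_lin_left: "tens (lin f v) w = lin (\<lambda>a. tens (f a) w) v"
  by (simp add: tens_def lin_lin)

lemma tens_sum_right: "tens v (sum f S) = (\<Sum>b\<in>S. tens v (f b))"
  by (induction S rule: infinite_finite_induct) auto

lemma tens_lin_right: "tens v (lin f w) = lin (\<lambda>b. tens v (f b)) w"
  by (simp add: lin_def[of f] lin_def[of _ w] tens_sum_right)

lemma lin_tens: "lin f (tens v w) = lin (\<lambda>a. lin (\<lambda>b. f (a, b)) w) v"
  by (simp add: tens_def lin_lin)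

lemma tens_lin_lin: "tens (lin f v) (lin g w) = lin (\<lambda>(a, b). tens (f a) (g b)) (tens v w)"
  by (simp only: tens_lin_left) (simp add: tens_lin_right lin_tens)

lemma lookup_tens: "lookup (tens v w) (a, b)
    = lookup v a * lookup w b"
proof -
  have "lookup (lin (\<lambda>b. unit (a', b)) w) (a, b) = (if a' = a then lookup w b else 0)" for a'
    by (auto simp: lookup_lin lookup_single when_def in_keys_iff if_distrib cong: if_cong)
  then have "lookup (tens v w) (a, b)
      = (\<Sum>a'\<in>keys v. if a' = a then lookup v a * lookup w b else 0)"
    unfolding tens_def lookup_lin[of _ v] by (intro sum.cong) auto
  then show ?thesis
    by (auto simp: in_keys_iff)
qed

lemma keys_tens: "keys (tens v w) = keys v \<times> keys w"
  by (auto simp: in_keys_iff lookup_tens)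

section \<open>Complexes of based vector spaces\<close>

definition based_complex :: "'a set \<Rightarrow> ('a \<Rightarrow> nat) \<Rightarrow> ('a \<Rightarrow> 'a \<Rightarrow>\<^sub>0 'k::field) \<Rightarrow> bool" where
  "based_complex B deg D \<longleftrightarrow>
     (\<forall>b\<in>B. keys (D b) \<subseteq> {b'\<in>B. Suc (deg b') = deg b} \<and> lin D (D b) = 0)"

text \<open>A contraction of the complex, by the homotopy \<open>s\<close>, onto a copy of its homology inside degree 0;
  \<open>p\<close> is the projection.\<close>

definition contraction :: "'a set \<Rightarrow> ('a \<Rightarrow> nat) \<Rightarrow> ('a \<Rightarrow> 'a \<Rightarrow>\<^sub>0 'k::field)
    \<Rightarrow> ('a \<Rightarrow> 'a \<Rightarrow>\<^sub>0 'k) \<Rightarrow> ('a \<Rightarrow> 'a \<Rightarrow>\<^sub>0 'k) \<Rightarrow> bool" where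
  "contraction B deg D p s \<longleftrightarrow>
     (\<forall>b\<in>B. keys (s b) \<subseteq> {b'\<in>B. deg b' = Suc (deg b)} \<and>
        keys (p b) \<subseteq> {b'\<in>B. deg b' = 0} \<and> (deg b \<noteq> 0 \<longrightarrow> p b = 0) \<and>
        lin D (s b) + lin s (D b) = unit b - p b \<and> lin p (D b) = 0)"

text \<open>Total differential with the Koszul sign, which depends on the degree of the left factor
  alone; hence the single degree function.\<close>

definition tensor_diff :: "('a \<Rightarrow> nat) \<Rightarrow> ('a \<Rightarrow> 'a \<Rightarrow>\<^sub>0 'k::field) \<Rightarrow> ('b \<Rightarrow> 'b \<Rightarrow>\<^sub>0 'k)
    \<Rightarrow> 'a \<times> 'b \<Rightarrow> ('a \<times> 'b) \<Rightarrow>\<^sub>0 'k" where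
  "tensor_diff deg D E = (\<lambda>(b, c). tens (D b) (unit c) + scl ((-1) ^ deg b) (tens (unit b) (E c)))"

lemma lin_tensor_diff:
  assumes "keys v \<subseteq> {b. deg b = i}"
  shows "lin (tensor_diff deg D E) (tens v w)
    = tens (lin D v) w + scl ((-1) ^ i) (tens v (lin E w))"
proof -
  have "lin (tensor_diff deg D E) (tens v w)
      = lin (\<lambda>b. tens (D b) w + scl ((-1) ^ deg b) (tens (unit b) (lin E w))) v"
    by (simp add: lin_tens tensor_diff_def lin_fun_add lin_fun_scl flip: tens_lin_right)
  also have "\<dots> = lin (\<lambda>b. tens (D b) w + scl ((-1) ^ i) (tens (unit b) (lin E w))) v"
    using assms by (intro lin_cong) auto
  finally show ?thesis
    by (simp add: lin_fun_add lin_fun_scl flip: tens_lin_left)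
qed

lemma keys_tensor_diff:
  assumes "keys (D b) \<subseteq> S" "keys (E c) \<subseteq> T"
  shows "keys (tensor_diff deg D E (b, c)) \<subseteq> S \<times> {c} \<union> {b} \<times> T"
proof -
  have "keys (tensor_diff deg D E (b, c))
      \<subseteq> keys (tens (D b) (unit c)) \<union> keys (tens (unit b) (E c))"
    unfolding tensor_diff_def using keys_add keys_scl by fastforce
  then show ?thesis using assms by (auto simp: keys_tens)
qed

lemma based_complex_tensor:
  assumes "based_complex B deg D" "based_complex C deg' E"
  shows "based_complex (B \<times> C) (\<lambda>x. deg (fst x) + deg' (snd x)) (tensor_diff deg D E)"
  unfolding based_complex_def
proof
  fix x assume "x \<in> B \<times> C"
  then obtain b c where x: "x = (b, c)" and b: "b \<in> B" and c: "c \<in> C" by auto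
  have D: "keys (D b) \<subseteq> {b'\<in>B. Suc (deg b') = deg b}" "lin D (D b) = 0"
    and E: "keys (E c) \<subseteq> {c'\<in>C. Suc (deg' c') = deg' c}" "lin E (E c) = 0"
    using assms b c by (auto simp: based_complex_def)
  have "keys (tensor_diff deg D E (b, c))
      \<subseteq> {y \<in> B \<times> C. Suc (deg (fst y) + deg' (snd y)) = deg b + deg' c}"
    using keys_tensor_diff[where b = b and c = c and deg = deg and D = D and E = E, OF D(1) E(1)] b c by fastforce
  moreover have "lin (tensor_diff deg D E) (tensor_diff deg D E (b, c)) = 0"
  \<comment> \<open>The mixed terms \<open>D b \<otimes> E c\<close> carry opposite signs and
    cancel. A nonzero \<open>D b\<close> supplies a basis element \<open>b'\<close> one degree
    lower, which avoids the exponent \<open>deg b - 1\<close> in degree 0.\<close>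
  proof (cases "D b = 0")
    case True
    then show ?thesis
      by (simp add: tensor_diff_def[of deg D E] lin_tensor_diff[of _ _ "deg b", unfolded tensor_diff_def] E)
  next
    case False
    then obtain b' where "b' \<in> keys (D b)" by (metis equals0I keys_eq_empty)
    then have 1: "deg b = Suc (deg b')" using D by auto
    have "keys (D b) \<subseteq> {x. deg x = deg b'}" using D(1) 1 by auto
    from lin_tensor_diff[OF this, of D E "unit c"] lin_tensor_diff[of "unit b" deg "deg b" D E "E c"]
    show ?thesis by (simp add: tensor_diff_def[of deg D E] D E 1)
  qed
  ultimately show "keys (tensor_diff deg D E x)
      \<subseteq> {y \<in> B \<times> C. Suc (deg (fst y) + deg' (snd y)) = deg (fst x) + deg' (snd x)}
    \<and> lin (tensor_diff deg D E) (tensor_diff deg D E x) = 0" by (simp add: x)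
qed

text \<open>Kuenneth in explicit form. Split id \<otimes> id - p \<otimes> q as (id - p) \<otimes>
  id + p \<otimes> (id - q); the homotopies s \<otimes> id and p \<otimes> t of the two summands add
  up. The second one carries no sign, since \<open>p\<close> can be nonzero only in degree
  0.\<close>

lemma contraction_tensor:
  fixes D :: "'a \<Rightarrow> 'a \<Rightarrow>\<^sub>0 'k::field" and E :: "'b \<Rightarrow> 'b \<Rightarrow>\<^sub>0 'k"
  assumes BC: "based_complex B deg D" "based_complex C deg' E"
    and con: "contraction B deg D p s" "contraction C deg' E q t"
  shows "contraction (B \<times> C) (\<lambda>x. deg (fst x) + deg' (snd x)) (tensor_diff deg D E)
    (\<lambda>(b, c). tens (p b) (q c)) (\<lambda>(b, c). tens (s b) (unit c) + tens (p b) (t c))"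
    (is "contraction _ _ ?T ?P ?S")
  unfolding contraction_def
proof
  fix x assume "x \<in> B \<times> C"
  then obtain b c where x: "x = (b, c)" and b: "b \<in> B" and c: "c \<in> C" by auto
  have D: "keys (D b) \<subseteq> {b'\<in>B. Suc (deg b') = deg b}"
    and E: "keys (E c) \<subseteq> {c'\<in>C. Suc (deg' c') = deg' c}"
    using BC b c by (auto simp: based_complex_def)
  have s: "keys (s b) \<subseteq> {b'\<in>B. deg b' = Suc (deg b)}" "keys (p b) \<subseteq> {b'\<in>B. deg b' = 0}"
    "deg b \<noteq> 0 \<Longrightarrow> p b = 0" "lin D (s b) + lin s (D b) = unit b - p b" "lin p (D b) = 0"
    using con b by (auto simp: contraction_def)
  have t: "keys (t c) \<subseteq> {b'\<in>C. deg' b' = Suc (deg' c)}" "keys (q c) \<subseteq> {b'\<in>C. deg' b' = 0}"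
    "deg' c \<noteq> 0 \<Longrightarrow> q c = 0" "lin E (t c) + lin t (E c) = unit c - q c" "lin q (E c) = 0"
    using con c by (auto simp: contraction_def)
  have linS: "lin ?S (tens v w) = tens (lin s v) w + tens (lin p v) (lin t w)" for v w
    by (simp add: lin_tens lin_fun_add flip: tens_lin_left tens_lin_right)
  have linP: "lin ?P (tens v w) = tens (lin p v) (lin q w)" for v w
    by (simp add: lin_tens flip: tens_lin_left tens_lin_right)
  have "keys (?S (b, c)) \<subseteq> keys (tens (s b) (unit c)) \<union> keys (tens (p b) (t c))"
    by (simp add: keys_add)
  also have "\<dots> \<subseteq> {y \<in> B \<times> C. deg (fst y) + deg' (snd y) = Suc (deg b + deg' c)}"
    using s(1-3) t(1) c by (cases "deg b = 0") (fastforce simp: keys_tens)+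
  finally have 1: "keys (?S (b, c)) \<subseteq> {y \<in> B \<times> C. deg (fst y) + deg' (snd y) = Suc (deg b + deg' c)}" .
  have 2: "keys (?P (b, c)) \<subseteq> {y \<in> B \<times> C. deg (fst y) + deg' (snd y) = 0}"
    using s t by (auto simp: keys_tens)
  have 3: "deg b + deg' c \<noteq> 0 \<longrightarrow> ?P (b, c) = 0"
    using s t by auto
  have 4: "lin ?P (?T (b, c)) = 0"
    by (simp add: tensor_diff_def linP s t)
  have "lin D (p b) = 0"
  proof (rule lin_eq_0)
    fix a assume "a \<in> keys (p b)"
    then have "a \<in> B" "deg a = 0" using s by auto
    then have "keys (D a) = {}" using BC(1) by (force simp: based_complex_def)
    then show "D a = 0" by simp
  qed
  moreover have "keys (p b) \<subseteq> {x. deg x = 0}" "keys (s b) \<subseteq> {x. deg x = Suc (deg b)}"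
    using s by auto
  ultimately have T: "lin ?T (?S (b, c)) = tens (lin D (s b)) (unit c)
     + scl ((-1) ^ Suc (deg b)) (tens (s b) (E c)) + tens (p b) (lin E (t c))"
    by (simp add: lin_tensor_diff)
  have sign: "scl ((-1) ^ deg b) (tens (p b) v) = tens (p b) v" for v :: "'b \<Rightarrow>\<^sub>0 'k"
    using s(3) by (cases "deg b = 0") auto
  have "lin ?S (?T (b, c)) = tens (lin s (D b)) (unit c)
     + (scl ((-1) ^ deg b) (tens (s b) (E c)) + tens (p b) (lin t (E c)))"
    by (simp add: tensor_diff_def linS s sign)
  with T have "lin ?T (?S (b, c)) + lin ?S (?T (b, c))
      = tens (lin D (s b) + lin s (D b)) (unit c) + tens (p b) (lin E (t c) + lin t (E c))"
    by simp
  also have "\<dots> = unit (b, c) - ?P (b, c)"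
    unfolding s t by (simp add: tens_def[of "unit _" "unit _"])
  finally have 5: "lin ?T (?S (b, c)) + lin ?S (?T (b, c)) = unit (b, c) - ?P (b, c)" .
  show "keys (?S x) \<subseteq> {y \<in> B \<times> C. deg (fst y) + deg' (snd y) = Suc (deg (fst x) + deg' (snd x))}
    \<and> keys (?P x) \<subseteq> {y \<in> B \<times> C. deg (fst y) + deg' (snd y) = 0}
    \<and> (deg (fst x) + deg' (snd x) \<noteq> 0 \<longrightarrow> ?P x = 0)
    \<and> lin ?T (?S x) + lin ?S (?T x) = unit x - ?P x \<and> lin ?P (?T x) = 0"
    unfolding x fst_conv snd_conv using 1 2 3 4 5 by blast
qed

text \<open>The homotopy identity evaluated at \<open>v\<close>: the terms containing
  \<open>D v\<close> and \<open>p v\<close> drop out.\<close>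

lemma contraction_boundary:
  assumes "contraction B deg D p s" "keys v \<subseteq> {b\<in>B. deg b = i}" "lin D v = 0" "lin p v = 0"
  shows "keys (lin s v) \<subseteq> {b\<in>B. deg b = Suc i} \<and> lin D (lin s v) = v"
proof
  show "keys (lin s v) \<subseteq> {b\<in>B. deg b = Suc i}"
    using assms by (intro keys_lin_subset) (force simp: contraction_def)
  have "lin D (lin s v) + lin s (lin D v) = lin (\<lambda>b. lin D (s b) + lin s (D b)) v"
    by (simp add: lin_lin lin_fun_add)
  also have "\<dots> = lin (\<lambda>b. unit b - p b) v"
    using assms by (intro lin_cong) (auto simp: contraction_def)
  also have "\<dots> = v" using assms by (simp add: lin_fun_diff)
  finally show "lin D (lin s v) = v" using assms by simp
qed

lemma contraction_projection_eq_0: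
  assumes "contraction B deg D p s" "keys v \<subseteq> {b\<in>B. deg b = Suc i}"
  shows "lin p v = 0"
  using assms by (intro lin_eq_0) (fastforce simp: contraction_def)

text \<open>The homotopy is built degree by degree: the error \<open>f b - s (D b)\<close> is a
  cycle by the equation one degree below, and exactness in positive degrees provides a preimage.
  Degree 0 is left to a hypothesis because the complexes at hand may have homology there. The
  applications take \<open>f = id - p\<close>, which yields contractions.\<close>

lemma null_homotopy:
  fixes D :: "'a \<Rightarrow> 'a \<Rightarrow>\<^sub>0 'k::field"
  assumes BD: "based_complex B deg D"
    and exact: "\<And>i v. keys v \<subseteq> {b\<in>B. deg b = Suc i} \<Longrightarrow> lin D v = 0
       \<Longrightarrow> \<exists>w. keys w \<subseteq> {b\<in>B. deg b = Suc (Suc i)} \<and> lin D w = v"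
    and f: "\<And>b. b \<in> B \<Longrightarrow> keys (f b) \<subseteq> {b'\<in>B. deg b' = deg b}"
       "\<And>b. b \<in> B \<Longrightarrow> lin D (f b) = lin f (D b)"
    and f0: "\<And>b. b \<in> B \<Longrightarrow> deg b = 0 \<Longrightarrow> \<exists>w. keys w \<subseteq> {b\<in>B. deg b = Suc 0} \<and> lin D w = f b"
  shows "\<exists>s. \<forall>b\<in>B. keys (s b) \<subseteq> {b'\<in>B. deg b' = Suc (deg b)} \<and> lin D (s b) + lin s (D b) = f b"
proof -
  \<comment> \<open>\<open>s\<close> solves the equation in degree \<open>n\<close> relative to a
    solution \<open>s0\<close> one degree lower. Keeping \<open>s0\<close> in the invariant is what
    makes the next error a cycle; for \<open>n = 0\<close> any \<open>s0\<close> fits, as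
    \<open>D b = 0\<close> there.\<close>
  define R where "R n s0 s \<longleftrightarrow> (\<forall>b\<in>B. deg b = n \<longrightarrow>
    keys (s b) \<subseteq> {b'\<in>B. deg b' = Suc n} \<and> lin D (s b) = f b - lin s0 (D b))"
    for n and s0 s :: "'a \<Rightarrow> 'a \<Rightarrow>\<^sub>0 'k"
  have D0: "D b = 0" if "b \<in> B" "deg b = 0" for b
  proof -
    have "keys (D b) = {}" using BD that by (force simp: based_complex_def)
    then show ?thesis by simp
  qed
  have "\<exists>S. \<forall>n. (\<exists>s0. R n s0 (S n)) \<and> R (Suc n) (S n) (S (Suc n))"
  proof (rule dependent_nat_choice)
    have "\<exists>s. \<forall>b\<in>{b\<in>B. deg b = 0}. keys (s b) \<subseteq> {b'\<in>B. deg b' = Suc 0} \<and> lin D (s b) = f b"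
      by (rule bchoice) (use f0 in blast)
    then show "\<exists>s s0. R 0 s0 s" unfolding R_def using D0 by force
  next
    fix s n assume "\<exists>s0. R n s0 s"
    then obtain s0 where s0: "R n s0 s" ..
    have "\<exists>s'. \<forall>b\<in>{b\<in>B. deg b = Suc n}. keys (s' b) \<subseteq> {b'\<in>B. deg b' = Suc (Suc n)}
        \<and> lin D (s' b) = f b - lin s (D b)"
    proof (rule bchoice, clarify)
      fix b assume b: "b \<in> B" "deg b = Suc n"
      then have Db: "keys (D b) \<subseteq> {b'\<in>B. deg b' = n}" "lin D (D b) = 0"
        using BD by (fastforce simp: based_complex_def)+
      have "keys (lin s (D b)) \<subseteq> {b'\<in>B. deg b' = Suc n}"
        using s0 Db by (intro keys_lin_subset) (auto simp: R_def)
      then have 1: "keys (f b - lin s (D b)) \<subseteq> {b\<in>B. deg b = Suc n}"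
        using f(1)[of b] b keys_diff[of "f b" "lin s (D b)"] by auto
      have "lin (\<lambda>a. lin D (s a)) (D b) = lin (\<lambda>a. f a - lin s0 (D a)) (D b)"
        using s0 Db by (intro lin_cong) (auto simp: R_def)
      also have "\<dots> = lin f (D b) - lin s0 (lin D (D b))"
        by (simp add: lin_fun_diff lin_lin)
      finally have "lin D (f b - lin s (D b)) = 0"
        using f(2) b Db by (simp add: lin_lin)
      from exact[OF 1 this]
      show "\<exists>w. keys w \<subseteq> {b'\<in>B. deg b' = Suc (Suc n)} \<and> lin D w = f b - lin s (D b)" .
    qed
    then obtain s' where "R (Suc n) s s'" unfolding R_def by blast
    then show "\<exists>s'. (\<exists>s0. R (Suc n) s0 s') \<and> R (Suc n) s s'" by blast
  qed
  then obtain S where S: "\<And>n. \<exists>s0. R n s0 (S n)" "\<And>n. R (Suc n) (S n) (S (Suc n))" by blast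
  have "keys (S (deg b) b) \<subseteq> {b'\<in>B. deg b' = Suc (deg b)}
      \<and> lin D (S (deg b) b) + lin (\<lambda>b. S (deg b) b) (D b) = f b" if b: "b \<in> B" for b
  proof (cases "deg b")
    case 0
    then show ?thesis using S(1)[of 0] b D0 by (auto simp: R_def)
  next
    case (Suc n)
    then have "lin (\<lambda>b. S (deg b) b) (D b) = lin (S n) (D b)"
      using BD b by (intro lin_cong) (fastforce simp: based_complex_def)
    then show ?thesis using S(2)[of n] b Suc by (auto simp: R_def)
  qed
  then show ?thesis by (intro exI[of _ "\<lambda>b. S (deg b) b"]) blast
qed

section \<open>Squarefree resolutions\<close>

text \<open>The strands of a resolution of \<open>S/I_X\<close>, not of \<open>I_X\<close>: the root \<open>r\<close> spans the copy of \<open>S\<close> in degree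
  0, hence \<open>F i\<close> in a resolution of \<open>I_X\<close> corresponds to degree \<open>i + 1\<close>.\<close>

locale squarefree_resolution =
  fixes X :: "'n::finite set set" and r :: 'a and B :: "'a set" and deg :: "'a \<Rightarrow> nat"
    and L :: "'a \<Rightarrow> 'n set" and D :: "'a \<Rightarrow> 'a \<Rightarrow>\<^sub>0 'k::field"
  assumes finite_deg: "finite {b\<in>B. deg b = i}"
    and deg_0: "{b\<in>B. deg b = 0} = {r}"
    and label_root: "L r = {}"
    and keys_D: "b \<in> B \<Longrightarrow> keys (D b) \<subseteq> {b'\<in>B. Suc (deg b') = deg b \<and> L b' \<subseteq> L b}"
    and D_D: "b \<in> B \<Longrightarrow> lin D (D b) = 0"
    and exact: "keys v \<subseteq> {b\<in>B. deg b = Suc i \<and> L b \<subseteq> A} \<Longrightarrow> lin D v = 0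
       \<Longrightarrow> \<exists>w. keys w \<subseteq> {b\<in>B. deg b = Suc (Suc i) \<and> L b \<subseteq> A} \<and> lin D w = v"
    and image: "(\<exists>b\<in>B. deg b = 1 \<and> L b \<subseteq> A \<and> D b \<noteq> 0) \<longleftrightarrow> A \<notin> X"
begin

definition "strand A = {b\<in>B. L b \<subseteq> A}"

lemma root: "r \<in> B" "deg r = 0"
  using deg_0 by auto

lemma D_root: "D r = 0"
proof -
  have "keys (D r) = {}" using keys_D[OF root(1)] root(2) by auto
  then show ?thesis by simp
qed

lemma D_deg_1: "b \<in> B \<Longrightarrow> deg b = 1 \<Longrightarrow> D b = Poly_Mapping.single r (lookup (D b) r)"
proof -
  assume "b \<in> B" "deg b = 1"
  then have "keys (D b) \<subseteq> {r}" using keys_D[of b] deg_0 by auto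
  then show ?thesis
    by (intro poly_mapping_eqI) (auto simp: lookup_single when_def in_keys_iff)
qed

lemma based_complex_strand: "based_complex (strand A) deg D"
  using keys_D D_D unfolding based_complex_def strand_def by fastforce

lemma root_boundary:
  assumes "A \<notin> X"
  obtains u where "keys u \<subseteq> {b\<in>strand A. deg b = 1}" "lin D u = unit r"
proof -
  obtain b where b: "b \<in> B" "deg b = 1" "L b \<subseteq> A" "D b \<noteq> 0"
    using assms image by blast
  define c where "c = lookup (D b) r"
  have Db: "D b = Poly_Mapping.single r c" using D_deg_1 b by (simp add: c_def)
  then have "c \<noteq> 0" using b by auto
  then show ?thesis
    using b Db that[of "Poly_Mapping.single b (1 / c)"] by (auto simp: strand_def split: if_splits)
qed

lemma strand_exact:
  assumes "keys v \<subseteq> {b\<in>strand A. deg b = Suc i}" "lin D v = 0"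
  shows "\<exists>w. keys w \<subseteq> {b\<in>strand A. deg b = Suc (Suc i)} \<and> lin D w = v"
  using exact[of v i A] assms by (auto simp: strand_def conj_ac)

lemma D_0_strand: "A \<in> X \<Longrightarrow> b \<in> strand A \<Longrightarrow> deg b = 1 \<Longrightarrow> D b = 0"
  using image[of A] by (auto simp: strand_def)

text \<open>The strand of S/I_X at \<open>A\<close> is K for a face and 0 for a nonface. Hence
  \<open>p\<close> keeps the root in the first case, where no element of degree 1 hits it, and is 0
  in the second, where \<open>root_boundary\<close> starts the homotopy.\<close>

lemma strand_contraction:
  obtains p s where "contraction (strand A) deg D p s"
proof -
  define p where "p b = (if deg b = 0 \<and> A \<in> X then unit b else 0 :: 'a \<Rightarrow>\<^sub>0 'k)" for b
  have pD: "lin p (D b) = 0" if b: "b \<in> strand A" for b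
  proof (cases "A \<in> X \<and> deg b = 1")
    case True
    then have "D b = 0" using D_0_strand b by blast
    then show ?thesis by simp
  next
    case False
    then show ?thesis
      using keys_D[of b] b by (intro lin_eq_0) (force simp: p_def strand_def)
  qed
  have "\<exists>s. \<forall>b\<in>strand A. keys (s b) \<subseteq> {b'\<in>strand A. deg b' = Suc (deg b)}
      \<and> lin D (s b) + lin s (D b) = unit b - p b"
  proof (rule null_homotopy[OF based_complex_strand strand_exact])
    fix b assume b: "b \<in> strand A"
    show "keys (unit b - p b) \<subseteq> {b' \<in> strand A. deg b' = deg b}"
      using b by (auto simp: p_def)
    have "lin D (p b) = 0"
      using b D_root deg_0 by (auto simp: p_def strand_def)
    then show "lin D (unit b - p b) = lin (\<lambda>b. unit b - p b) (D b)"
      by (simp add: lin_fun_diff pD[OF b])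
    assume "deg b = 0"
    then have [simp]: "b = r" using b deg_0 by (auto simp: strand_def)
    show "\<exists>w. keys w \<subseteq> {b \<in> strand A. deg b = Suc 0} \<and> lin D w = unit b - p b"
    proof (cases "A \<in> X")
      case True
      then show ?thesis using root by (intro exI[of _ 0]) (auto simp: p_def)
    next
      case False
      from root_boundary[OF this] show ?thesis using False by (auto simp: p_def)
    qed
  qed
  then obtain s where s: "\<forall>b\<in>strand A. keys (s b) \<subseteq> {b'\<in>strand A. deg b' = Suc (deg b)}
      \<and> lin D (s b) + lin s (D b) = unit b - p b" ..
  then have "contraction (strand A) deg D p s"
    using pD by (auto simp: contraction_def p_def)
  then show ?thesis by (rule that)
qed

text \<open>Deleting the root and shifting degrees gives a resolution of the ideal itself; in a strand
  where the ideal is nonzero, its zeroth homology is spanned by a preimage \<open>u\<close> of the root.\<close>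

definition "D_pos b = (if deg b \<le> 1 then 0 else D b)"

definition "pos A = {b\<in>strand A. deg b \<noteq> 0}"

lemma lin_D_pos: "keys v \<subseteq> {b. deg b > 1} \<Longrightarrow> lin D_pos v = lin D v"
  by (rule lin_cong) (force simp: D_pos_def)

lemma based_complex_pos: "based_complex (pos A) (\<lambda>b. deg b - 1) D_pos"
  unfolding based_complex_def
proof (intro ballI conjI)
  fix b assume b: "b \<in> pos A"
  have "b \<in> B" "L b \<subseteq> A" using b by (auto simp: pos_def strand_def)
  then show "keys (D_pos b) \<subseteq> {b' \<in> pos A. Suc (deg b' - 1) = deg b - 1}"
    using keys_D[of b] by (auto simp: pos_def strand_def D_pos_def)
  show "lin D_pos (D_pos b) = 0"
  proof (cases "deg b \<le> 2")
    case True
    then show ?thesis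
      using keys_D[of b] b by (intro lin_eq_0) (force simp: pos_def strand_def D_pos_def split: if_splits)
  next
    case False
    then have "lin D_pos (D b) = lin D (D b)"
      using keys_D[of b] b by (intro lin_D_pos) (force simp: pos_def strand_def)
    then show ?thesis using D_D[of b] b False by (simp add: D_pos_def pos_def strand_def)
  qed
qed

text \<open>Writing \<open>D b\<close> as c r for \<open>b\<close> of degree 1,
  \<open>lin (\<lambda>_. u) (D b)\<close> is c u. If \<open>D u = r\<close>, then b - c u is a
  cycle of the untruncated complex, and exactness there in degree 1 supplies the homotopy in the
  lowest degree. The subtraction in \<open>deg b - 1\<close> is a true one, as \<open>pos A\<close>
  omits degree 0.\<close>

lemma pos_contraction:
  obtains u :: "'a \<Rightarrow>\<^sub>0 'k" and s where
    "contraction (pos A) (\<lambda>b. deg b - 1) D_pos (\<lambda>b. if deg b = 1 then lin (\<lambda>_. u) (D b) else 0) s"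
proof -
  obtain u where u: "keys u \<subseteq> {b\<in>strand A. deg b = 1}" "A \<notin> X \<Longrightarrow> lin D u = unit r"
  proof (cases "A \<in> X")
    case True
    \<comment> \<open>On the strand of a face \<open>D\<close> vanishes in degree 1, so the
      projection is 0 and the default \<open>u = 0\<close> fits.\<close>
    then show ?thesis using that[of 0] by simp
  next
    case False
    with root_boundary show ?thesis using that by blast
  qed
  define p where "p b = (if deg b = 1 then lin (\<lambda>_. u) (D b) else 0)" for b
  have keys_p: "keys (p b) \<subseteq> {b'\<in>pos A. deg b' - 1 = 0}" for b
    unfolding p_def using u(1) by (auto intro!: keys_lin_subset simp: pos_def dest!: subsetD)
  have pD: "lin p (D b) = 0" if b: "b \<in> B" "deg b \<noteq> 1" for b
  proof (cases "deg b = 2")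
    case True
    then have "lin p (D b) = lin (\<lambda>b'. lin (\<lambda>_. u) (D b')) (D b)"
      using keys_D[of b] b by (intro lin_cong) (force simp: p_def)
    then show ?thesis using D_D b by (simp flip: lin_lin)
  next
    case False
    then show ?thesis
      using keys_D[of b] b by (intro lin_eq_0) (force simp: p_def)
  qed
  have "\<exists>s. \<forall>b\<in>pos A. keys (s b) \<subseteq> {b'\<in>pos A. deg b' - 1 = Suc (deg b - 1)}
      \<and> lin D_pos (s b) + lin s (D_pos b) = unit b - p b"
  proof (rule null_homotopy[OF based_complex_pos])
    fix i and v :: "'a \<Rightarrow>\<^sub>0 'k"
    assume v: "keys v \<subseteq> {b \<in> pos A. deg b - 1 = Suc i}" "lin D_pos v = 0"
    have "lin D v = 0"
      using v lin_D_pos[of v] by (force simp: subset_iff)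
    moreover have "keys v \<subseteq> {b\<in>strand A. deg b = Suc (Suc i)}"
      using v by (auto simp: pos_def)
    ultimately obtain w where w: "keys w \<subseteq> {b\<in>strand A. deg b = Suc (Suc (Suc i))}" "lin D w = v"
      using strand_exact by blast
    then show "\<exists>w. keys w \<subseteq> {b \<in> pos A. deg b - 1 = Suc (Suc i)} \<and> lin D_pos w = v"
      using lin_D_pos[of w] by (intro exI[of _ w]) (force simp: pos_def)
  next
    fix b assume b: "b \<in> pos A"
    then have bB: "b \<in> B" by (simp add: pos_def strand_def)
    have "keys (unit b - p b) \<subseteq> keys (unit b :: 'a \<Rightarrow>\<^sub>0 'k) \<union> keys (p b)" by (rule keys_diff)
    also have "\<dots> \<subseteq> {b' \<in> pos A. deg b' - 1 = deg b - 1}"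
      using b keys_p[of b] by (auto simp: p_def pos_def split: if_splits)
    finally show "keys (unit b - p b) \<subseteq> {b' \<in> pos A. deg b' - 1 = deg b - 1}" .
    have "lin D_pos (p b) = 0"
      using keys_p[of b] by (intro lin_eq_0) (auto simp: D_pos_def)
    moreover have "lin p (D_pos b) = 0"
      using pD[OF bB] by (auto simp: D_pos_def)
    ultimately show "lin D_pos (unit b - p b) = lin (\<lambda>b. unit b - p b) (D_pos b)"
      by (simp add: lin_fun_diff)
    assume "deg b - 1 = 0"
    then have b1: "deg b = 1" using b by (auto simp: pos_def)
    have "lin D (unit b - p b) = 0"
    proof (cases "A \<in> X")
      case True
      then show ?thesis using D_0_strand b b1 by (simp add: p_def pos_def)
    next
      case False
      then have "lin D (p b) = lin (\<lambda>_. unit r) (D b)"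
        using b1 u by (simp add: p_def lin_lin)
      also have "\<dots> = lin unit (D b)"
        using keys_D[OF bB] b1 deg_0 by (intro lin_cong) auto
      finally show ?thesis by simp
    qed
    moreover have "keys (unit b - p b) \<subseteq> {b'\<in>strand A. deg b' = Suc 0}"
      using \<open>keys (unit b - p b) \<subseteq> {b' \<in> pos A. deg b' - 1 = deg b - 1}\<close> b1
      by (auto simp: pos_def)
    ultimately obtain w where "keys w \<subseteq> {b\<in>strand A. deg b = Suc (Suc 0)}" "lin D w = unit b - p b"
      using strand_exact by blast
    then show "\<exists>w. keys w \<subseteq> {b \<in> pos A. deg b - 1 = Suc 0} \<and> lin D_pos w = unit b - p b"
      using lin_D_pos[of w] by (intro exI[of _ w]) (force simp: pos_def)
  qed
  then obtain s where "\<forall>b\<in>pos A. keys (s b) \<subseteq> {b'\<in>pos A. deg b' - 1 = Suc (deg b - 1)}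
      \<and> lin D_pos (s b) + lin s (D_pos b) = unit b - p b" ..
  moreover have "lin p (D_pos b) = 0" if "b \<in> pos A" for b
    using pD[of b] that by (auto simp: D_pos_def pos_def strand_def)
  ultimately have "contraction (pos A) (\<lambda>b. deg b - 1) D_pos p s"
    using keys_p by (auto simp: contraction_def) (auto simp: p_def)
  then show ?thesis using that unfolding p_def by blast
qed

end

section \<open>Products of squarefree resolutions\<close>

lemma tens_eq_0_iff: "tens v w = 0 \<longleftrightarrow> v = 0 \<or> w = 0"
  by (metis keys_tens keys_eq_empty Times_empty)

text \<open>Positive degrees are exact because the product of the two contractions of a strand
  projects to degree 0. In degree 1 the basis consists of elements \<open>(b, q)\<close> and
  \<open>(r, c)\<close>, so the root is hit at \<open>A\<close> as soon as one factor hits its own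
  root: the nonfaces of \<open>X\<close> and \<open>Y\<close> are united, which means
  \<open>X \<inter> Y\<close>.\<close>

lemma squarefree_resolution_tensor:
  fixes D :: "'a \<Rightarrow> 'a \<Rightarrow>\<^sub>0 'k::field" and E :: "'b \<Rightarrow> 'b \<Rightarrow>\<^sub>0 'k"
  assumes "squarefree_resolution X r B deg L D" "squarefree_resolution Y q C deg' M E"
  shows "squarefree_resolution (X \<inter> Y) (r, q) (B \<times> C) (\<lambda>x. deg (fst x) + deg' (snd x))
    (\<lambda>x. L (fst x) \<union> M (snd x)) (tensor_diff deg D E)"
proof -
  interpret F: squarefree_resolution X r B deg L D by fact
  interpret G: squarefree_resolution Y q C deg' M E by fact
  let ?deg = "\<lambda>x. deg (fst x) + deg' (snd x)"
  let ?L = "\<lambda>x. L (fst x) \<union> M (snd x)"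
  let ?T = "tensor_diff deg D E"
  have strand: "{x\<in>B \<times> C. ?deg x = i \<and> ?L x \<subseteq> A} = {x \<in> F.strand A \<times> G.strand A. ?deg x = i}" for i A
    by (auto simp: F.strand_def G.strand_def)
  show ?thesis
  proof
    fix i
    have "{x\<in>B \<times> C. ?deg x = i} \<subseteq> (\<Union>j\<le>i. {b\<in>B. deg b = j}) \<times> (\<Union>j\<le>i. {c\<in>C. deg' c = j})"
      by auto
    then show "finite {x\<in>B \<times> C. ?deg x = i}"
      by (rule finite_subset) (use F.finite_deg G.finite_deg in auto)
    show "{x\<in>B \<times> C. ?deg x = 0} = {(r, q)}"
      using F.deg_0 G.deg_0 by auto
    show "?L (r, q) = {}" by (simp add: F.label_root G.label_root)
  next
    fix x assume "x \<in> B \<times> C"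
    then obtain b c where x: "x = (b, c)" and b: "b \<in> B" and c: "c \<in> C" by auto
    show "keys (?T x) \<subseteq> {y\<in>B \<times> C. Suc (?deg y) = ?deg x \<and> ?L y \<subseteq> ?L x}"
      using keys_tensor_diff[where b = b and c = c and deg = deg and D = D and E = E,
          OF F.keys_D[OF b] G.keys_D[OF c]] b c by (fastforce simp: x)
    have "based_complex (F.strand UNIV \<times> G.strand UNIV) ?deg ?T"
      by (intro based_complex_tensor F.based_complex_strand G.based_complex_strand)
    then show "lin ?T (?T x) = 0"
      using b c by (simp add: based_complex_def F.strand_def G.strand_def x)
  next
    fix v i A assume v: "keys v \<subseteq> {x\<in>B \<times> C. ?deg x = Suc i \<and> ?L x \<subseteq> A}" "lin ?T v = 0"
    obtain p s where ps: "contraction (F.strand A) deg D p s" by (rule F.strand_contraction)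
    obtain p' s' where ps': "contraction (G.strand A) deg' E p' s'" by (rule G.strand_contraction)
    obtain P S where con: "contraction (F.strand A \<times> G.strand A) ?deg ?T P S"
      using contraction_tensor[OF F.based_complex_strand G.based_complex_strand ps ps'] by blast
    have "lin P v = 0"
      using contraction_projection_eq_0[OF con v(1)[unfolded strand]] .
    then show "\<exists>w. keys w \<subseteq> {x\<in>B \<times> C. ?deg x = Suc (Suc i) \<and> ?L x \<subseteq> A} \<and> lin ?T w = v"
      using contraction_boundary[OF con v(1)[unfolded strand] v(2)] unfolding strand by blast
  next
    fix A
    show "(\<exists>x\<in>B \<times> C. ?deg x = 1 \<and> ?L x \<subseteq> A \<and> ?T x \<noteq> 0) \<longleftrightarrow> A \<notin> X \<inter> Y"
    proof
      assume "\<exists>x\<in>B \<times> C. ?deg x = 1 \<and> ?L x \<subseteq> A \<and> ?T x \<noteq> 0"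
      then obtain b c where bc: "b \<in> B" "c \<in> C" "deg b + deg' c = 1" "L b \<subseteq> A" "M c \<subseteq> A" "?T (b, c) \<noteq> 0"
        by auto
      from bc(3) consider "deg b = 1" "deg' c = 0" | "deg b = 0" "deg' c = 1" by linarith
      then show "A \<notin> X \<inter> Y"
      proof cases
        case 1
        then have "c = q" using G.deg_0 bc by auto
        then have "D b \<noteq> 0" using bc G.D_root by (auto simp: tensor_diff_def)
        then show ?thesis using F.image[of A] bc 1 by blast
      next
        case 2
        then have "b = r" using F.deg_0 bc by auto
        then have "E c \<noteq> 0" using bc F.D_root by (auto simp: tensor_diff_def)
        then show ?thesis using G.image[of A] bc 2 by blast
      qed
    next
      assume "A \<notin> X \<inter> Y"
      then consider "A \<notin> X" | "A \<notin> Y" by blast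
      then show "\<exists>x\<in>B \<times> C. ?deg x = 1 \<and> ?L x \<subseteq> A \<and> ?T x \<noteq> 0"
      proof cases
        case 1
        then obtain b where "b \<in> B" "deg b = 1" "L b \<subseteq> A" "D b \<noteq> 0" using F.image by blast
        then show ?thesis using G.root G.label_root G.D_root
          by (intro bexI[of _ "(b, q)"]) (auto simp: tensor_diff_def tens_eq_0_iff)
      next
        case 2
        then obtain b where "b \<in> C" "deg' b = 1" "M b \<subseteq> A" "E b \<noteq> 0" using G.image by blast
        then show ?thesis using F.root F.label_root F.D_root
          by (intro bexI[of _ "(r, b)"]) (auto simp: tensor_diff_def tens_eq_0_iff)
      qed
    qed
  qed
qed

text \<open>The augmentation of the tensor product of the truncations sends \<open>b \<otimes> c\<close> in bidegree (1, 1) to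
  \<open>D b \<otimes> E c\<close>, a multiple of the root \<open>(r, q)\<close>.\<close>

lemma squarefree_resolution_tensor_pos:
  fixes D :: "'a \<Rightarrow> 'a \<Rightarrow>\<^sub>0 'k::field" and E :: "'b \<Rightarrow> 'b \<Rightarrow>\<^sub>0 'k"
  assumes "squarefree_resolution X r B deg L D" "squarefree_resolution Y q C deg' M E"
  obtains T :: "'a \<times> 'b \<Rightarrow> ('a \<times> 'b) \<Rightarrow>\<^sub>0 'k" where "squarefree_resolution (X \<union> Y) (r, q)
    (insert (r, q) {x\<in>B \<times> C. deg (fst x) \<noteq> 0 \<and> deg' (snd x) \<noteq> 0})
    (\<lambda>x. deg (fst x) + deg' (snd x) - 1) (\<lambda>x. L (fst x) \<union> M (snd x)) T"
proof -
  interpret F: squarefree_resolution X r B deg L D by fact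
  interpret G: squarefree_resolution Y q C deg' M E by fact
  \<comment> \<open>\<open>?d\<close> is the total degree of the two shifted complexes. A new root
    below them raises it by one, so \<open>?deg\<close> is \<open>?d + 1\<close> off the root, while
    truncated subtraction gives the root degree 0.\<close>
  let ?d = "\<lambda>x. (deg (fst x) - 1) + (deg' (snd x) - 1)"
  let ?deg = "\<lambda>x. deg (fst x) + deg' (snd x) - 1"
  let ?L = "\<lambda>x. L (fst x) \<union> M (snd x)"
  let ?B = "insert (r, q) {x\<in>B \<times> C. deg (fst x) \<noteq> 0 \<and> deg' (snd x) \<noteq> 0}"
  define T' where "T' = tensor_diff (\<lambda>b. deg b - 1) F.D_pos G.D_pos"
  define T where "T x = (if deg (fst x) = 1 \<and> deg' (snd x) = 1 then tens (D (fst x)) (E (snd x))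
    else T' x)" for x
  have pos: "{x\<in>?B. ?deg x = Suc i \<and> ?L x \<subseteq> A} = {x \<in> F.pos A \<times> G.pos A. ?d x = i}" for i A
    using F.root G.root by (auto simp: F.pos_def F.strand_def G.pos_def G.strand_def)
  have T'_bc: "based_complex (F.pos A \<times> G.pos A) ?d T'" for A
    unfolding T'_def by (intro based_complex_tensor F.based_complex_pos G.based_complex_pos)
  have T_root: "T (r, q) = 0"
    by (simp add: T_def T'_def tensor_diff_def F.D_pos_def G.D_pos_def F.root G.root)
  have T'_1: "T' x = 0" if "deg (fst x) = 1" "deg' (snd x) = 1" for x
    using that by (cases x) (simp add: T'_def tensor_diff_def F.D_pos_def G.D_pos_def)
  have lin_T_1: "lin T (tens v w) = tens (lin D v) (lin E w)"
    if "keys v \<subseteq> {b. deg b = 1}" "keys w \<subseteq> {c. deg' c = 1}" for v w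
  proof -
    have "lin T (tens v w) = lin (\<lambda>(b, c). tens (D b) (E c)) (tens v w)"
      using that by (intro lin_cong) (auto simp: T_def keys_tens)
    then show ?thesis by (simp add: lin_tens flip: tens_lin_left tens_lin_right)
  qed
  have lin_T: "lin T v = lin T' v" if "keys v \<subseteq> {x \<in> F.pos A \<times> G.pos A. ?d x = Suc i}" for v i A
    using that by (intro lin_cong) (auto simp: T_def)
  have D_1: "keys (D b) \<subseteq> {r}" if "b \<in> B" "deg b = 1" for b
    using F.keys_D[OF that(1)] that F.deg_0 by auto
  have E_1: "keys (E b) \<subseteq> {q}" if "b \<in> C" "deg' b = 1" for b
    using G.keys_D[OF that(1)] that G.deg_0 by auto
  have "squarefree_resolution (X \<union> Y) (r, q) ?B ?deg ?L T"
  proof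
    fix i
    have "{x\<in>?B. ?deg x = i} \<subseteq> insert (r, q) ((\<Union>j\<le>Suc i. {b\<in>B. deg b = j}) \<times> (\<Union>j\<le>Suc i. {c\<in>C. deg' c = j}))"
      by auto
    then show "finite {x\<in>?B. ?deg x = i}"
      by (rule finite_subset) (use F.finite_deg G.finite_deg in auto)
    show "{x\<in>?B. ?deg x = 0} = {(r, q)}"
      using F.root G.root by auto
    show "?L (r, q) = {}" by (simp add: F.label_root G.label_root)
  next
    fix x assume "x \<in> ?B"
    then consider "x = (r, q)"
      | b c where "x = (b, c)" "b \<in> B" "c \<in> C" "deg b = 1" "deg' c = 1"
      | b c where "x = (b, c)" "b \<in> B" "c \<in> C" "deg b + deg' c > 2" "deg b \<noteq> 0" "deg' c \<noteq> 0"
      by fastforce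
    then have "keys (T x) \<subseteq> {y\<in>?B. Suc (?deg y) = ?deg x \<and> ?L y \<subseteq> ?L x} \<and> lin T (T x) = 0"
    proof cases
      case 1
      then show ?thesis by (simp add: T_root)
    next
      case 2
      then have "keys (T x) \<subseteq> {(r, q)}"
        using D_1[of b] E_1[of c] by (auto simp: T_def keys_tens)
      then show ?thesis
        using 2 F.root G.root F.label_root G.label_root T_root by (auto intro!: lin_eq_0)
    next
      case 3
      have Tx: "T x = T' x" using 3 by (auto simp: T_def)
      have "keys (F.D_pos b) \<subseteq> {b'\<in>B. Suc (deg b') = deg b \<and> deg b' \<noteq> 0 \<and> L b' \<subseteq> L b}"
        using F.keys_D[of b] 3 by (auto simp: F.D_pos_def)
      moreover have "keys (G.D_pos c) \<subseteq> {b'\<in>C. Suc (deg' b') = deg' c \<and> deg' b' \<noteq> 0 \<and> M b' \<subseteq> M c}"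
        using G.keys_D[of c] 3 by (auto simp: G.D_pos_def)
      ultimately have keys_T': "keys (T' x) \<subseteq> {b'\<in>B. Suc (deg b') = deg b \<and> deg b' \<noteq> 0 \<and> L b' \<subseteq> L b} \<times> {c}
           \<union> {b} \<times> {b'\<in>C. Suc (deg' b') = deg' c \<and> deg' b' \<noteq> 0 \<and> M b' \<subseteq> M c}"
        unfolding T'_def 3(1) by (rule keys_tensor_diff)
      then have keys_T: "keys (T' x) \<subseteq> {y\<in>?B. Suc (?deg y) = ?deg x \<and> ?L y \<subseteq> ?L x}"
        using 3 by fastforce
      have x: "x \<in> F.pos UNIV \<times> G.pos UNIV"
        using 3 by (auto simp: F.pos_def F.strand_def G.pos_def G.strand_def)
      have "lin T (T' x) = 0"
      \<comment> \<open>For \<open>?d x = 1\<close> the map \<open>T'\<close> lands in bidegree (1,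
        1), where \<open>T\<close> is the augmentation; the composite is then
        \<open>D (D b) \<otimes> E c\<close> or \<open>D b \<otimes> E (E c)\<close>. In higher
        degrees \<open>T\<close> and \<open>T'\<close> agree on the image.\<close>
      proof (cases "?d x = 1")
        case True
        then consider "deg b = 2" "deg' c = 1" | "deg b = 1" "deg' c = 2"
          using 3 by (auto simp: 3(1)) linarith
        then show ?thesis
        proof cases
          case 1
          then have "T' x = tens (D b) (unit c)"
            by (simp add: 3(1) T'_def tensor_diff_def F.D_pos_def G.D_pos_def)
          moreover have "keys (D b) \<subseteq> {b. deg b = 1}" using F.keys_D[of b] 1 3 by auto
          ultimately show ?thesis using 1 3 by (simp add: lin_T_1 F.D_D)
        next
          case 2
          then have "T' x = tens (unit b) (E c)"
            by (simp add: 3(1) T'_def tensor_diff_def F.D_pos_def G.D_pos_def)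
          moreover have "keys (E c) \<subseteq> {b. deg' b = 1}" using G.keys_D[of c] 2 3 by auto
          ultimately show ?thesis using 2 3 by (simp add: lin_T_1 G.D_D)
        qed
      next
        case False
        then have "?d x \<ge> 2" using 3(4-6) by (simp add: 3(1))
        then obtain j where "?d x = Suc (Suc j)" by (metis add_2_eq_Suc le_Suc_ex)
        then have "lin T (T' x) = lin T' (T' x)"
          using T'_bc[of UNIV] x by (intro lin_T[of _ UNIV j]) (fastforce simp: based_complex_def)
        then show ?thesis using T'_bc[of UNIV] x unfolding based_complex_def by simp
      qed
      then show ?thesis using Tx keys_T by simp
    qed
    then show "keys (T x) \<subseteq> {y\<in>?B. Suc (?deg y) = ?deg x \<and> ?L y \<subseteq> ?L x}" "lin T (T x) = 0"
      by blast+
  next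
    fix v i A assume v: "keys v \<subseteq> {x\<in>?B. ?deg x = Suc i \<and> ?L x \<subseteq> A}" "lin T v = 0"
    note v' = v(1)[unfolded pos]
    obtain u s where us: "contraction (F.pos A) (\<lambda>b. deg b - 1) F.D_pos
        (\<lambda>b. if deg b = 1 then lin (\<lambda>_. u) (D b) else 0) s"
      by (rule F.pos_contraction)
    obtain u' s' where us': "contraction (G.pos A) (\<lambda>b. deg' b - 1) G.D_pos
        (\<lambda>b. if deg' b = 1 then lin (\<lambda>_. u') (E b) else 0) s'"
      by (rule G.pos_contraction)
    define P where "P = (\<lambda>(b, c). tens (if deg b = 1 then lin (\<lambda>_. u) (D b) else 0)
      (if deg' c = 1 then lin (\<lambda>_. u') (E c) else 0))"
    obtain S where con: "contraction (F.pos A \<times> G.pos A) ?d T' P S"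
      using contraction_tensor[OF F.based_complex_pos G.based_complex_pos us us']
      unfolding P_def T'_def by blast
    have "lin T' v = 0 \<and> lin P v = 0"
    proof (cases i)
      case 0
      have 1: "deg (fst x) = 1 \<and> deg' (snd x) = 1" if "x \<in> keys v" for x
        using v' that by (auto simp: 0 F.pos_def G.pos_def)
      then have "lin T' v = 0" by (intro lin_eq_0) (simp add: T'_1)
      \<comment> \<open>In bidegree (1, 1) the projection factors through the augmentation:
        replacing the root in \<open>T x\<close> by \<open>u \<otimes> u'\<close> gives
        \<open>P x\<close>. So \<open>T v = 0\<close> forces \<open>P v = 0\<close>, the condition
        for \<open>v\<close> to be a boundary.\<close>
      moreover have "lin P v = lin (\<lambda>x. lin (\<lambda>_. tens u u') (T x)) v"
        using 1 by (intro lin_cong)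
          (auto simp: P_def T_def tens_lin_lin split_def)
      ultimately show ?thesis using v(2) by (simp flip: lin_lin)
    next
      case (Suc j)
      have "lin P v = 0"
        using contraction_projection_eq_0[OF con v'[unfolded Suc]] .
      then show ?thesis using lin_T[OF v'[unfolded Suc]] v(2) by simp
    qed
    then have "keys (lin S v) \<subseteq> {x \<in> F.pos A \<times> G.pos A. ?d x = Suc i} \<and> lin T' (lin S v) = v"
      using contraction_boundary[OF con v'] by blast
    then show "\<exists>w. keys w \<subseteq> {x\<in>?B. ?deg x = Suc (Suc i) \<and> ?L x \<subseteq> A} \<and> lin T w = v"
      unfolding pos using lin_T[of "lin S v" A i] by (intro exI[of _ "lin S v"]) simp
  next
    fix A
    show "(\<exists>x\<in>?B. ?deg x = 1 \<and> ?L x \<subseteq> A \<and> T x \<noteq> 0) \<longleftrightarrow> A \<notin> X \<union> Y"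
    proof
      assume "\<exists>x\<in>?B. ?deg x = 1 \<and> ?L x \<subseteq> A \<and> T x \<noteq> 0"
      then obtain b c where bc: "b \<in> B" "c \<in> C" "deg b + deg' c - 1 = 1" "L b \<subseteq> A" "M c \<subseteq> A"
          "T (b, c) \<noteq> 0" "deg b \<noteq> 0" "deg' c \<noteq> 0"
        using F.root G.root by auto
      then have 1: "deg b = 1" "deg' c = 1" by linarith+
      then have "D b \<noteq> 0" "E c \<noteq> 0" using bc by (auto simp: T_def)
      then show "A \<notin> X \<union> Y" using F.image[of A] G.image[of A] bc 1 by blast
    next
      assume "A \<notin> X \<union> Y"
      then obtain b c where "b \<in> B" "deg b = 1" "L b \<subseteq> A" "D b \<noteq> 0"
          "c \<in> C" "deg' c = 1" "M c \<subseteq> A" "E c \<noteq> 0"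
        using F.image[of A] G.image[of A] by blast
      then show "\<exists>x\<in>?B. ?deg x = 1 \<and> ?L x \<subseteq> A \<and> T x \<noteq> 0"
        by (intro bexI[of _ "(b, c)"]) (auto simp: T_def tens_eq_0_iff)
    qed
  qed
  then show ?thesis by (rule that)
qed

section \<open>Existence of minimal squarefree resolutions\<close>

text \<open>Gaussian elimination, one coordinate at a time. Closure under \<open>v - scl c w\<close>
  makes a nonempty \<open>V\<close> a subspace. The coefficients of a combination are indexed by the
  spanning vectors themselves, so \<open>lin (\<lambda>x. x)\<close> evaluates it.\<close>

lemma finite_spanning_subset:
  fixes V :: "('a \<Rightarrow>\<^sub>0 'k::field) set"
  assumes "finite J" "\<And>v. v \<in> V \<Longrightarrow> keys v \<subseteq> J"
    and "\<And>v w c. v \<in> V \<Longrightarrow> w \<in> V \<Longrightarrow> v - scl c w \<in> V"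
  shows "\<exists>G. finite G \<and> G \<subseteq> V \<and> (\<forall>v\<in>V. \<exists>w. keys w \<subseteq> G \<and> lin (\<lambda>x. x) w = v)"
  using assms
proof (induction J arbitrary: V rule: finite_induct)
  case empty
  then have "v = 0" if "v \<in> V" for v using that by force
  then show ?case by (intro exI[of _ "{}"]) auto
next
  case (insert j J)
  define V' where "V' = {v\<in>V. lookup v j = 0}"
  have "\<exists>G. finite G \<and> G \<subseteq> V' \<and> (\<forall>v\<in>V'. \<exists>w. keys w \<subseteq> G \<and> lin (\<lambda>x. x) w = v)"
  proof (rule insert.IH)
    fix v assume "v \<in> V'"
    then show "keys v \<subseteq> J" using insert.prems(1)[of v] by (auto simp: V'_def in_keys_iff)
  next
    fix v w c assume "v \<in> V'" "w \<in> V'"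
    then show "v - scl c w \<in> V'" using insert.prems(2) by (auto simp: V'_def lookup_minus)
  qed
  then obtain G where G: "finite G" "G \<subseteq> V'" "\<And>v. v \<in> V' \<Longrightarrow> \<exists>w. keys w \<subseteq> G \<and> lin (\<lambda>x. x) w = v"
    by blast
  show ?case
  proof (cases "V = V'")
    case True
    then show ?thesis using G by blast
  next
    case False
    then obtain u where u: "u \<in> V" "lookup u j \<noteq> 0" by (auto simp: V'_def)
    have "\<exists>w. keys w \<subseteq> insert u G \<and> lin (\<lambda>x. x) w = v" if v: "v \<in> V" for v
    proof -
      define c where "c = lookup v j / lookup u j"
      have "v - scl c u \<in> V'" using u v insert.prems(2) by (auto simp: V'_def lookup_minus c_def)
      then obtain w where w: "keys w \<subseteq> G" "lin (\<lambda>x. x) w = v - scl c u" using G by blast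
      show ?thesis
      proof (intro exI conjI)
        show "keys (w + Poly_Mapping.single u c) \<subseteq> insert u G"
          using keys_add[of w "Poly_Mapping.single u c"] w by (auto split: if_splits)
        show "lin (\<lambda>x. x) (w + Poly_Mapping.single u c) = v" using w by simp
      qed
    qed
    then show ?thesis using G u by (intro exI[of _ "insert u G"]) (auto simp: V'_def)
  qed
qed

text \<open>A generating set of least cardinality is minimal: a relation in strand \<open>A\<close> that involves a
  generator labelled exactly \<open>A\<close> would make that generator redundant.\<close>

lemma minimal_graded_generators:
  fixes V :: "'n::finite set \<Rightarrow> ('a \<Rightarrow>\<^sub>0 'k::field) set"
  assumes J: "finite J" and V: "\<forall>A. \<forall>v\<in>V A. keys v \<subseteq> J"
    "\<forall>A. \<forall>v\<in>V A. \<forall>w\<in>V A. \<forall>c. v - scl c w \<in> V A"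
  shows "\<exists>G. finite G \<and> (\<forall>p\<in>G. snd p \<in> V (fst p)) \<and>
    (\<forall>A. \<forall>v\<in>V A. \<exists>w. keys w \<subseteq> {p\<in>G. fst p \<subseteq> A} \<and> lin snd w = v) \<and>
    (\<forall>A w. keys w \<subseteq> {p\<in>G. fst p \<subseteq> A} \<longrightarrow> lin snd w = 0 \<longrightarrow> (\<forall>p\<in>keys w. fst p \<noteq> A))"
proof -
  define gen where "gen G \<longleftrightarrow> finite G \<and> (\<forall>p\<in>G. snd p \<in> V (fst p)) \<and>
    (\<forall>A. \<forall>v\<in>V A. \<exists>w. keys w \<subseteq> {p\<in>G. fst p \<subseteq> A} \<and> lin snd w = v)" for G
  have "\<forall>A. \<exists>G. finite G \<and> G \<subseteq> V A \<and> (\<forall>v\<in>V A. \<exists>w. keys w \<subseteq> G \<and> lin (\<lambda>x. x) w = v)"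
    by (intro allI finite_spanning_subset[OF J]) (use V in blast)+
  from choice[OF this] obtain g where g: "\<And>A. finite (g A)" "\<And>A. g A \<subseteq> V A"
      "\<And>A v. v \<in> V A \<Longrightarrow> \<exists>w. keys w \<subseteq> g A \<and> lin (\<lambda>x. x) w = v"
    by blast
  \<comment> \<open>Some finite generating set exists: spanning sets of the finitely many
    \<open>V A\<close>, each vector tagged with its label.\<close>
  have "gen (Sigma UNIV g)"
    unfolding gen_def
  proof (intro conjI ballI allI)
    show "finite (Sigma UNIV g)" using g by auto
    fix p assume "p \<in> Sigma UNIV g"
    then show "snd p \<in> V (fst p)" using subsetD[OF g(2)] by auto
  next
    fix A v assume "v \<in> V A"
    then obtain w where w: "keys w \<subseteq> g A" "lin (\<lambda>x. x) w = v" using g by blast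
    have "keys (lin (\<lambda>x. unit (A, x)) w) \<subseteq> {p \<in> Sigma UNIV g. fst p \<subseteq> A}"
      using w by (intro keys_lin_subset) auto
    moreover have "lin snd (lin (\<lambda>x. unit (A, x)) w) = v"
      using w by (simp add: lin_lin)
    ultimately show "\<exists>w. keys w \<subseteq> {p \<in> Sigma UNIV g. fst p \<subseteq> A} \<and> lin snd w = v" by blast
  qed
  from ex_has_least_nat[of gen, OF this, of card]
  obtain G where G: "gen G" "\<And>G'. gen G' \<Longrightarrow> card G \<le> card G'" by blast
  have "fst p \<noteq> A" if w: "keys w \<subseteq> {p\<in>G. fst p \<subseteq> A}" "lin snd w = 0" and p: "p \<in> keys w" for A w p
  proof
    assume A: "fst p = A"
    have "gen (G - {p})"
      unfolding gen_def
    proof (intro conjI ballI allI)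
      show "finite (G - {p})" using G by (simp add: gen_def)
      show "snd q \<in> V (fst q)" if "q \<in> G - {p}" for q using G that by (simp add: gen_def)
    next
      fix A' v assume "v \<in> V A'"
      then obtain w' where w': "keys w' \<subseteq> {p\<in>G. fst p \<subseteq> A'}" "lin snd w' = v"
        using G(1) unfolding gen_def by blast
      show "\<exists>w. keys w \<subseteq> {q \<in> G - {p}. fst q \<subseteq> A'} \<and> lin snd w = v"
      proof (cases "p \<in> keys w'")
        case False
        then show ?thesis using w' by (intro exI[of _ w']) auto
      next
        case True
        then have AA': "A \<subseteq> A'" using w' A by auto
        \<comment> \<open>Subtracting this multiple of the relation \<open>w\<close> removes
          \<open>p\<close> from the representation \<open>w'\<close> of \<open>v\<close>. The result
          stays in the strand of \<open>A'\<close>, because \<open>p\<close> has label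
          \<open>A\<close> and occurs in \<open>w'\<close>, whence
          \<open>A \<subseteq> A'\<close>.\<close>
        define c where "c = lookup w' p / lookup w p"
        have "p \<notin> keys (w' - scl c w)"
          using p by (auto simp: in_keys_iff lookup_minus c_def)
        moreover have "keys (w' - scl c w) \<subseteq> keys w' \<union> keys w"
          using keys_diff[of w' "scl c w"] keys_scl[of c w] by blast
        ultimately have "keys (w' - scl c w) \<subseteq> {q \<in> G - {p}. fst q \<subseteq> A'}"
          using w w' AA' by blast
        then show ?thesis using w w' by (intro exI[of _ "w' - scl c w"]) simp
      qed
    qed
    then have "card G \<le> card (G - {p})" by (rule G(2))
    moreover have "p \<in> G" "finite G" using p w G by (auto simp: gen_def)
    ultimately show False by (meson card_Diff1_less leD)
  qed
  then have "\<forall>A w. keys w \<subseteq> {p\<in>G. fst p \<subseteq> A} \<longrightarrow> lin snd w = 0 \<longrightarrow> (\<forall>p\<in>keys w. fst p \<noteq> A)"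
    by (intro allI impI ballI)
  with G(1) show ?thesis unfolding gen_def by (intro exI[of _ G] conjI) (elim conjE, assumption)+
qed

text \<open>Renames the generators, pairs of a label and a vector, to pairs of numbers: otherwise
  the type of the basis elements would grow with every syzygy step. The first number records the
  homological degree and keeps the bases of different degrees disjoint.\<close>

lemma minimal_graded_generators_nat:
  fixes V :: "'n::finite set \<Rightarrow> ('a \<Rightarrow>\<^sub>0 'k::field) set" and n :: nat
  assumes "finite J" "\<forall>A. \<forall>v\<in>V A. keys v \<subseteq> J"
    "\<forall>A. \<forall>v\<in>V A. \<forall>w\<in>V A. \<forall>c. v - scl c w \<in> V A"
  shows "\<exists>(J' :: (nat \<times> nat) set) L D. finite J' \<and> J' \<subseteq> {n} \<times> UNIV \<and> (\<forall>b\<in>J'. D b \<in> V (L b)) \<and>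
    (\<forall>A. \<forall>v\<in>V A. \<exists>w. keys w \<subseteq> {b\<in>J'. L b \<subseteq> A} \<and> lin D w = v) \<and>
    (\<forall>A w. keys w \<subseteq> {b\<in>J'. L b \<subseteq> A} \<longrightarrow> lin D w = 0 \<longrightarrow> (\<forall>b\<in>keys w. L b \<noteq> A))"
proof -
  obtain G where G: "finite G" "\<forall>p\<in>G. snd p \<in> V (fst p)"
    "\<forall>A. \<forall>v\<in>V A. \<exists>w. keys w \<subseteq> {p\<in>G. fst p \<subseteq> A} \<and> lin snd w = v"
    "\<forall>A w. keys w \<subseteq> {p\<in>G. fst p \<subseteq> A} \<longrightarrow> lin snd w = 0 \<longrightarrow> (\<forall>p\<in>keys w. fst p \<noteq> A)"
    using minimal_graded_generators[where V = V, OF assms] by (elim exE conjE) (rule that, assumption+)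
  obtain e where e: "bij_betw e {0..<card G} G" using ex_bij_betw_nat_finite[OF G(1)] by blast
  define J' where "J' = {n} \<times> {0..<card G}"
  define i where "i p = (n, inv_into {0..<card G} e p)" for p
  have ei: "e (snd (i p)) = p" "i p \<in> J'" if "p \<in> G" for p
    using that e by (auto simp: i_def J'_def bij_betw_inv_into_right dest: bij_betwE[OF bij_betw_inv_into])
  have ie: "e (snd b) \<in> G" "i (e (snd b)) = b" if "b \<in> J'" for b
    using that e by (auto simp: i_def J'_def bij_betw_inv_into_left dest: bij_betwE)
  show ?thesis
  proof (rule exI[of _ J'], rule exI[of _ "\<lambda>b. fst (e (snd b))"],
      rule exI[of _ "\<lambda>b. snd (e (snd b))"], intro conjI ballI allI impI)
    show "finite J'" "J' \<subseteq> {n} \<times> UNIV" by (auto simp: J'_def)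
    show "snd (e (snd b)) \<in> V (fst (e (snd b)))" if "b \<in> J'" for b
      using ie(1)[OF that] G(2) by blast
  next
    fix A v assume "v \<in> V A"
    then obtain w where w: "keys w \<subseteq> {p\<in>G. fst p \<subseteq> A}" "lin snd w = v" using G(3) by blast
    have "keys (lin (\<lambda>p. unit (i p)) w) \<subseteq> {b\<in>J'. fst (e (snd b)) \<subseteq> A}"
    proof (rule keys_lin_subset)
      fix p assume "p \<in> keys w"
      then have "p \<in> G" "fst p \<subseteq> A" using w by auto
      then show "keys (unit (i p)) \<subseteq> {b\<in>J'. fst (e (snd b)) \<subseteq> A}" using ei by simp
    qed
    moreover have "lin (\<lambda>b. snd (e (snd b))) (lin (\<lambda>p. unit (i p)) w) = lin snd w"
      unfolding lin_lin using w ei by (intro lin_cong) auto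
    ultimately show "\<exists>w. keys w \<subseteq> {b\<in>J'. fst (e (snd b)) \<subseteq> A} \<and> lin (\<lambda>b. snd (e (snd b))) w = v"
      using w by blast
  next
    fix A w b assume w: "keys w \<subseteq> {b\<in>J'. fst (e (snd b)) \<subseteq> A}"
      "lin (\<lambda>b. snd (e (snd b))) w = 0" "b \<in> keys w"
    let ?w = "lin (\<lambda>b. unit (e (snd b))) w"
    have 1: "keys ?w \<subseteq> {p\<in>G. fst p \<subseteq> A}"
      using w ie by (intro keys_lin_subset) auto
    have 2: "lin snd ?w = 0" using w by (simp add: lin_lin)
    have inj: "e (snd a) = e (snd b) \<longleftrightarrow> a = b" if "a \<in> keys w" for a
    proof -
      have "a \<in> J'" "b \<in> J'" using w that by auto
      then show ?thesis by (metis ie(2))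
    qed
    have "lookup ?w (e (snd b)) = (\<Sum>a\<in>keys w. if a = b then lookup w a else 0)"
      unfolding lookup_lin by (intro sum.cong) (auto simp: lookup_single inj)
    then have "e (snd b) \<in> keys ?w" using w by (simp add: in_keys_iff)
    then show "fst (e (snd b)) \<noteq> A" using G(4) 1 2 by blast
  qed
qed

text \<open>Iterated minimal syzygies inside the strands: stage 0 generates the ideal, every later
  stage the cycles of the one before. A column of the next differential is a relation in the strand
  of its own label, so minimality of the stage below keeps generators with that very label out of
  its support.\<close>

lemma minimal_squarefree_resolution_exists:
  fixes X :: "'n::finite set set"
  assumes X: "abstract_simplicial_complex X"
  obtains B and L :: "nat \<times> nat \<Rightarrow> 'n set" and D :: "nat \<times> nat \<Rightarrow> (nat \<times> nat) \<Rightarrow>\<^sub>0 'k::field"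
  where "squarefree_resolution X (0, 0) B fst L D"
    "\<And>b b'. b \<in> B \<Longrightarrow> fst b \<ge> 2 \<Longrightarrow> b' \<in> keys (D b) \<Longrightarrow> L b' \<noteq> L b"
proof -
  define min where "min J L D \<longleftrightarrow>
     (\<forall>A w. keys w \<subseteq> {b\<in>J. L b \<subseteq> A} \<longrightarrow> lin D w = 0 \<longrightarrow> (\<forall>b\<in>keys w. L b \<noteq> A))"
    for J and L :: "nat \<times> nat \<Rightarrow> 'n set" and D :: "nat \<times> nat \<Rightarrow> (nat \<times> nat) \<Rightarrow>\<^sub>0 'k"
  define start where "start J L D \<longleftrightarrow>
     (\<forall>b\<in>J. keys (D b) \<subseteq> {(0, 0)} \<and> (D b \<noteq> 0 \<longrightarrow> L b \<notin> X)) \<and> (\<forall>A. A \<notin> X \<longrightarrow> (\<exists>b\<in>J. L b \<subseteq> A \<and> D b \<noteq> 0))"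
    for J and L :: "nat \<times> nat \<Rightarrow> 'n set" and D :: "nat \<times> nat \<Rightarrow> (nat \<times> nat) \<Rightarrow>\<^sub>0 'k"
  \<comment> \<open>Stage \<open>n\<close> holds the basis in degree \<open>n + 1\<close>, since
    degree 0 is the root alone; \<open>start\<close> ties stage 0 to \<open>X\<close>.\<close>
  define P where "P n = (\<lambda>(J, L, D). finite J \<and> J \<subseteq> {Suc n} \<times> UNIV \<and> min J L D \<and> (n = 0 \<longrightarrow> start J L D))" for n
  define Q where "Q = (\<lambda>(J, L, D :: nat \<times> nat \<Rightarrow> (nat \<times> nat) \<Rightarrow>\<^sub>0 'k) (J', L' :: nat \<times> nat \<Rightarrow> 'n set, D').
     (\<forall>b\<in>J'. keys (D' b) \<subseteq> {b'\<in>J. L b' \<subseteq> L' b} \<and> lin D (D' b) = 0) \<and>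
     (\<forall>A v. keys v \<subseteq> {b\<in>J. L b \<subseteq> A} \<longrightarrow> lin D v = 0 \<longrightarrow> (\<exists>w. keys w \<subseteq> {b\<in>J'. L' b \<subseteq> A} \<and> lin D' w = v)))"
  have "\<exists>f. \<forall>n. P n (f n) \<and> Q (f n) (f (Suc n))"
  proof (rule dependent_nat_choice)
    \<comment> \<open>The part of the ideal in strand \<open>A\<close>: the line through the root
      for a nonface, 0 for a face.\<close>
    define V where "V A = {v :: (nat \<times> nat) \<Rightarrow>\<^sub>0 'k. keys v \<subseteq> {(0, 0)} \<and> (A \<in> X \<longrightarrow> v = 0)}" for A
    have 1: "\<forall>A. \<forall>v\<in>V A. keys v \<subseteq> {(0, 0)}" by (simp add: V_def)
    have 2: "\<forall>A. \<forall>v\<in>V A. \<forall>w\<in>V A. \<forall>c. v - scl c w \<in> V A"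
    proof (intro allI ballI)
      fix A v w c assume vw: "v \<in> V A" "w \<in> V A"
      have "keys (v - scl c w) \<subseteq> keys v \<union> keys w"
        using keys_diff[of v "scl c w"] keys_scl[of c w] by blast
      then show "v - scl c w \<in> V A" using vw unfolding V_def by auto
    qed
    obtain J :: "(nat \<times> nat) set" and L D where JLD: "finite J" "J \<subseteq> {Suc 0} \<times> UNIV" "\<forall>b\<in>J. D b \<in> V (L b)"
        "\<forall>A. \<forall>v\<in>V A. \<exists>w. keys w \<subseteq> {b\<in>J. L b \<subseteq> A} \<and> lin D w = v"
        "\<forall>A w. keys w \<subseteq> {b\<in>J. L b \<subseteq> A} \<longrightarrow> lin D w = 0 \<longrightarrow> (\<forall>b\<in>keys w. L b \<noteq> A)"
      using minimal_graded_generators_nat[where n = "Suc 0" and V = V, OF finite.insertI[OF finite.emptyI] 1 2]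
      by (elim exE conjE) (rule that, assumption+)
    have "\<exists>b\<in>J. L b \<subseteq> A \<and> D b \<noteq> 0" if "A \<notin> X" for A
    proof -
      have "unit (0, 0) \<in> V A" using that by (simp add: V_def)
      then obtain w where w: "keys w \<subseteq> {b\<in>J. L b \<subseteq> A}" "lin D w = unit (0, 0)" using JLD(4) by blast
      then have "\<exists>b\<in>keys w. D b \<noteq> 0" using lin_eq_0[of w D] by auto
      then show ?thesis using w by blast
    qed
    then have "P 0 (J, L, D)"
      using JLD(1,2,3,5) by (auto simp: P_def min_def start_def V_def)
    then show "\<exists>x. P 0 x" ..
  next
    fix x n assume "P n x"
    then obtain J L D where x: "x = (J, L, D)" and JLD: "finite J" "J \<subseteq> {Suc n} \<times> UNIV" "min J L D"
      by (auto simp: P_def)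
    define V where "V A = {v. keys v \<subseteq> {b\<in>J. L b \<subseteq> A} \<and> lin D v = 0}" for A
    have 1: "\<forall>A. \<forall>v\<in>V A. keys v \<subseteq> J" by (auto simp: V_def)
    have 2: "\<forall>A. \<forall>v\<in>V A. \<forall>w\<in>V A. \<forall>c. v - scl c w \<in> V A"
    proof (intro allI ballI)
      fix A v w c assume vw: "v \<in> V A" "w \<in> V A"
      have "keys (v - scl c w) \<subseteq> keys v \<union> keys w"
        using keys_diff[of v "scl c w"] keys_scl[of c w] by blast
      then show "v - scl c w \<in> V A" using vw unfolding V_def by auto
    qed
    obtain J' :: "(nat \<times> nat) set" and L' D' where JLD': "finite J'" "J' \<subseteq> {Suc (Suc n)} \<times> UNIV" "\<forall>b\<in>J'. D' b \<in> V (L' b)"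
        "\<forall>A. \<forall>v\<in>V A. \<exists>w. keys w \<subseteq> {b\<in>J'. L' b \<subseteq> A} \<and> lin D' w = v"
        "\<forall>A w. keys w \<subseteq> {b\<in>J'. L' b \<subseteq> A} \<longrightarrow> lin D' w = 0 \<longrightarrow> (\<forall>b\<in>keys w. L' b \<noteq> A)"
      using minimal_graded_generators_nat[where n = "Suc (Suc n)" and V = V, OF JLD(1) 1 2]
      by (elim exE conjE) (rule that, assumption+)
    have "P (Suc n) (J', L', D')" using JLD'(1,2,5) by (simp add: P_def min_def)
    moreover have "Q x (J', L', D')" using JLD'(3,4) unfolding Q_def x V_def by simp
    ultimately show "\<exists>y. P (Suc n) y \<and> Q x y" by blast
  qed
  then obtain f where f: "\<And>n. P n (f n)" "\<And>n. Q (f n) (f (Suc n))" by blast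
  define J where "J n = fst (f n)" for n
  define L' where "L' n = fst (snd (f n))" for n
  define D' where "D' n = snd (snd (f n))" for n
  have J: "finite (J n)" "J n \<subseteq> {Suc n} \<times> UNIV" "min (J n) (L' n) (D' n)" "start (J 0) (L' 0) (D' 0)" for n
    using f(1)[of n] f(1)[of 0] by (auto simp: P_def J_def L'_def D'_def)
  have K: "keys (D' (Suc n) b) \<subseteq> {b'\<in>J n. L' n b' \<subseteq> L' (Suc n) b}" "lin (D' n) (D' (Suc n) b) = 0"
    if "b \<in> J (Suc n)" for n b
    using f(2)[of n] that by (auto simp: Q_def J_def L'_def D'_def split_beta)
  have ex: "\<exists>w. keys w \<subseteq> {b\<in>J (Suc n). L' (Suc n) b \<subseteq> A} \<and> lin (D' (Suc n)) w = v"
    if "keys v \<subseteq> {b\<in>J n. L' n b \<subseteq> A}" "lin (D' n) v = 0" for n A v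
    using f(2)[of n] that by (auto simp: Q_def J_def L'_def D'_def split_beta)
  define B where "B = insert (0, 0) (\<Union>n. J n)"
  define L where "L b = (case fst b of 0 \<Rightarrow> {} | Suc n \<Rightarrow> L' n b)" for b
  define D where "D b = (case fst b of 0 \<Rightarrow> 0 | Suc n \<Rightarrow> D' n b)" for b
  have fst_J: "fst b = Suc n" if "b \<in> J n" for b n using J(2)[of n] that by auto
  have B_Suc: "{b\<in>B. fst b = Suc n} = J n" for n
    using fst_J unfolding B_def by fastforce
  have B_0: "{b\<in>B. fst b = 0} = {(0, 0)}"
    using fst_J unfolding B_def by fastforce
  have L_J: "L b = L' n b" and D_J: "D b = D' n b" if "b \<in> J n" for b n
    using fst_J[OF that] by (auto simp: L_def D_def)
  have strand: "{b\<in>B. fst b = Suc n \<and> L b \<subseteq> A} = {b\<in>J n. L' n b \<subseteq> A}" for n A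
  proof -
    have "{b\<in>B. fst b = Suc n \<and> L b \<subseteq> A} = {b\<in>{b\<in>B. fst b = Suc n}. L b \<subseteq> A}" by blast
    then show ?thesis unfolding B_Suc using L_J by auto
  qed
  have lin_D: "lin D v = lin (D' n) v" if "keys v \<subseteq> J n" for n v
    using that D_J by (intro lin_cong) auto
  have B_cases: "(b = (0, 0) \<Longrightarrow> R) \<Longrightarrow> (b \<in> J 0 \<Longrightarrow> R) \<Longrightarrow> (\<And>n. b \<in> J (Suc n) \<Longrightarrow> R) \<Longrightarrow> R"
    if "b \<in> B" for b R
  proof -
    assume R: "b = (0, 0) \<Longrightarrow> R" "b \<in> J 0 \<Longrightarrow> R" "\<And>n. b \<in> J (Suc n) \<Longrightarrow> R"
    from that consider "b = (0, 0)" | n where "b \<in> J n" by (auto simp: B_def)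
    then show R
    proof cases
      case (2 n)
      then show ?thesis using R by (cases n) auto
    qed (rule R)
  qed
  have D_0: "D (0, 0) = 0" by (simp add: D_def)
  have L_0: "L (0, 0) = {}" by (simp add: L_def)
  have keys_D: "keys (D b) \<subseteq> {b'\<in>J n. L b' \<subseteq> L b}" if "b \<in> J (Suc n)" for b n
  proof -
    have "L b' = L' n b'" if "b' \<in> J n" for b' using that by (rule L_J)
    then have "{b'\<in>J n. L b' \<subseteq> L b} = {b'\<in>J n. L' n b' \<subseteq> L' (Suc n) b}"
      unfolding L_J[OF that] by (intro Collect_cong) metis
    then show ?thesis using K(1)[OF that] by (simp add: D_J[OF that])
  qed
  have keys_D0: "keys (D b) \<subseteq> {(0, 0)}" if "b \<in> J 0" for b
    using J(4) that by (simp add: D_J start_def)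
  have "squarefree_resolution X (0, 0) B fst L D"
  proof
    show "finite {b\<in>B. fst b = i}" for i
      using J(1) by (cases i) (simp_all add: B_Suc B_0)
    show "{b\<in>B. fst b = 0} = {(0, 0)}" by (fact B_0)
    show "L (0, 0) = {}" by (fact L_0)
  next
    fix b assume b: "b \<in> B"
    show "keys (D b) \<subseteq> {b'\<in>B. Suc (fst b') = fst b \<and> L b' \<subseteq> L b}"
    proof (rule B_cases[OF b])
      assume "b = (0, 0)"
      then show ?thesis by (simp add: D_0)
    next
      assume b: "b \<in> J 0"
      then have "fst b = 1" using J(2)[of 0] by auto
      then show ?thesis using keys_D0[OF b] L_0 by (auto simp: B_def)
    next
      fix n assume b: "b \<in> J (Suc n)"
      then have "fst b = Suc (Suc n)" using J(2)[of "Suc n"] by auto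
      then show ?thesis using keys_D[OF b] B_Suc[of n] by auto
    qed
    show "lin D (D b) = 0"
    proof (rule B_cases[OF b])
      assume "b = (0, 0)"
      then show ?thesis by (simp add: D_0)
    next
      assume b: "b \<in> J 0"
      show ?thesis using keys_D0[OF b] D_0 by (intro lin_eq_0) auto
    next
      fix n assume b: "b \<in> J (Suc n)"
      then have "lin D (D b) = lin (D' n) (D b)" using keys_D[OF b] by (intro lin_D) auto
      then show ?thesis using K(2)[OF b] by (simp add: D_J[OF b])
    qed
  next
    fix v i A assume v: "keys v \<subseteq> {b\<in>B. fst b = Suc i \<and> L b \<subseteq> A}" "lin D v = 0"
    have "lin (D' i) v = 0" using v lin_D[of v i] unfolding strand by auto
    then obtain w where w: "keys w \<subseteq> {b\<in>J (Suc i). L' (Suc i) b \<subseteq> A}" "lin (D' (Suc i)) w = v"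
      using ex v(1) unfolding strand by blast
    then have "lin D w = v" using lin_D[of w "Suc i"] by auto
    then show "\<exists>w. keys w \<subseteq> {b\<in>B. fst b = Suc (Suc i) \<and> L b \<subseteq> A} \<and> lin D w = v"
      using w unfolding strand by blast
  next
    fix A
    have "(\<exists>b\<in>B. fst b = 1 \<and> L b \<subseteq> A \<and> D b \<noteq> 0)
        \<longleftrightarrow> (\<exists>b\<in>{b\<in>B. fst b = Suc 0}. L b \<subseteq> A \<and> D b \<noteq> 0)"
      unfolding One_nat_def by blast
    also have "\<dots> \<longleftrightarrow> (\<exists>b\<in>J 0. L' 0 b \<subseteq> A \<and> D' 0 b \<noteq> 0)"
      unfolding B_Suc by (rule bex_cong[OF refl]) (simp add: L_J D_J)
    \<comment> \<open>Closure of \<open>X\<close> under subsets enters here: every set containing a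
      nonface label is again a nonface.\<close>
    also have "\<dots> \<longleftrightarrow> A \<notin> X"
      using J(4) X unfolding start_def abstract_simplicial_complex_def by blast
    finally show "(\<exists>b\<in>B. fst b = 1 \<and> L b \<subseteq> A \<and> D b \<noteq> 0) \<longleftrightarrow> A \<notin> X" .
  qed
  moreover have "L b' \<noteq> L b" if b: "b \<in> B" "fst b \<ge> 2" and b': "b' \<in> keys (D b)" for b b'
  proof -
    obtain n where n: "b \<in> J (Suc n)"
      using b J(2)[of 0] by (elim B_cases) auto
    have "b' \<in> J n" using keys_D[OF n] b' by auto
    moreover have "L' n b' \<noteq> L' (Suc n) b"
      using J(3)[of n] K[OF n] b' unfolding min_def D_J[OF n] by blast
    ultimately show ?thesis using n by (simp add: L_J)
  qed
  ultimately show ?thesis by (rule that)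
qed

section \<open>Comparison of free resolutions\<close>

text \<open>Exact at every place except 0, so a free resolution of the cokernel of
  \<open>\<phi> 0\<close>. For ideals this cokernel will be S/I with \<open>n 0 = 1\<close>, which
  lets two resolutions be compared over the identity at place 0.\<close>

definition matrix_resolution :: "(nat \<Rightarrow> nat) \<Rightarrow> (nat \<Rightarrow> 'r::comm_ring_1 mat) \<Rightarrow> bool" where
  "matrix_resolution n \<phi> \<longleftrightarrow> (\<forall>i. \<phi> i \<in> carrier_mat (n i) (n (Suc i)) \<and>
     mat_kernel (\<phi> i) = (\<lambda>w. \<phi> (Suc i) *\<^sub>v w) ` carrier_vec (n (Suc (Suc i))))"

lemma mult_mat_unit_vec:
  fixes M :: "'r::comm_ring_1 mat"
  assumes "M \<in> carrier_mat r n" "j < n"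
  shows "M *\<^sub>v unit_vec n j = col M j"
proof (rule eq_vecI)
  fix i assume "i < dim_vec (col M j)"
  then show "(M *\<^sub>v unit_vec n j) $ i = col M j $ i"
    using assms scalar_prod_right_unit[of j n "row M i"] by auto
qed (use assms in auto)

text \<open>Projectivity of free modules: one lifted vector for each column of
  \<open>M\<close>.\<close>

lemma matrix_lift:
  assumes M: "M \<in> carrier_mat r n" and N: "N \<in> carrier_mat r m"
    and img: "\<And>j. j < n \<Longrightarrow> col M j \<in> (\<lambda>w. N *\<^sub>v w) ` carrier_vec m"
  obtains X where "X \<in> carrier_mat m n" "N * X = M"
proof -
  have "\<exists>x. \<forall>j. j < n \<longrightarrow> x j \<in> carrier_vec m \<and> N *\<^sub>v x j = col M j"
    using img by (intro choice) force
  then obtain x where x: "\<And>j. j < n \<Longrightarrow> x j \<in> carrier_vec m \<and> N *\<^sub>v x j = col M j" by blast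
  define X where "X = mat_of_cols m (map x [0..<n])"
  have X: "X \<in> carrier_mat m n" by (auto simp: X_def)
  have "N * X = M"
  proof (rule eq_matI)
    fix i j assume ij: "i < dim_row M" "j < dim_col M"
    then have "col X j = x j" using x M by (auto simp: X_def col_mat_of_cols)
    then have "(N * X) $$ (i, j) = (N *\<^sub>v x j) $ i" using ij X M N by simp
    then show "(N * X) $$ (i, j) = M $$ (i, j)" using x ij M by simp
  qed (use M N X in auto)
  with X show ?thesis by (rule that)
qed

context
  fixes n :: "nat \<Rightarrow> nat" and \<phi> :: "nat \<Rightarrow> 'r::comm_ring_1 mat"
  assumes res: "matrix_resolution n \<phi>"
begin

lemma matrix_resolution_carrier: "\<phi> i \<in> carrier_mat (n i) (n (Suc i))"
  using res by (simp add: matrix_resolution_def)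

lemma matrix_resolution_kernel:
  assumes "v \<in> carrier_vec (n (Suc i))"
  shows "\<phi> i *\<^sub>v v = 0\<^sub>v (n i) \<longleftrightarrow>
     v \<in> (\<lambda>w. \<phi> (Suc i) *\<^sub>v w) ` carrier_vec (n (Suc (Suc i)))"
proof -
  have "\<phi> i *\<^sub>v v = 0\<^sub>v (n i) \<longleftrightarrow> v \<in> mat_kernel (\<phi> i)"
    unfolding mat_kernel[OF matrix_resolution_carrier] using assms by simp
  then show ?thesis using res by (simp add: matrix_resolution_def)
qed

lemma matrix_resolution_comp_vec:
  assumes "w \<in> carrier_vec (n (Suc (Suc i)))"
  shows "\<phi> i *\<^sub>v (\<phi> (Suc i) *\<^sub>v w) = 0\<^sub>v (n i)"
proof (subst matrix_resolution_kernel)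
  show "\<phi> (Suc i) *\<^sub>v w \<in> carrier_vec (n (Suc i))"
    using matrix_resolution_carrier[of "Suc i"] assms by (rule mult_mat_vec_carrier)
qed (use assms in blast)

lemma matrix_resolution_comp: "\<phi> i * \<phi> (Suc i) = 0\<^sub>m (n i) (n (Suc (Suc i)))"
proof (rule eq_matI)
  note c = matrix_resolution_carrier[of i] matrix_resolution_carrier[of "Suc i"]
  fix a b assume ab: "a < dim_row (0\<^sub>m (n i) (n (Suc (Suc i))) :: 'r mat)"
    "b < dim_col (0\<^sub>m (n i) (n (Suc (Suc i))) :: 'r mat)"
  have "col (\<phi> (Suc i)) b = \<phi> (Suc i) *\<^sub>v unit_vec (n (Suc (Suc i))) b"
    using c ab by (simp add: mult_mat_unit_vec)
  then have "\<phi> i *\<^sub>v col (\<phi> (Suc i)) b = 0\<^sub>v (n i)"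
    using matrix_resolution_comp_vec by simp
  then have "(\<phi> i *\<^sub>v col (\<phi> (Suc i)) b) $ a = 0" using ab by simp
  then show "(\<phi> i * \<phi> (Suc i)) $$ (a, b) = 0\<^sub>m (n i) (n (Suc (Suc i))) $$ (a, b)"
    using ab c by simp
qed (use matrix_resolution_carrier[of i] matrix_resolution_carrier[of "Suc i"] in auto)

lemma matrix_resolution_lift:
  assumes M: "M \<in> carrier_mat (n (Suc i)) m" and 0: "\<phi> i * M = 0\<^sub>m (n i) m"
  obtains Z where "Z \<in> carrier_mat (n (Suc (Suc i))) m" "\<phi> (Suc i) * Z = M"
proof (rule matrix_lift[OF M matrix_resolution_carrier])
  fix j assume j: "j < m"
  have "\<phi> i *\<^sub>v col M j = col (\<phi> i * M) j"
    using j M matrix_resolution_carrier[of i] by (intro col_mult2[symmetric]) auto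
  also have "\<dots> = 0\<^sub>v (n i)" using j 0 by (simp add: col_zero)
  finally show "col M j \<in> (\<lambda>w. \<phi> (Suc i) *\<^sub>v w) ` carrier_vec (n (Suc (Suc i)))"
    using matrix_resolution_kernel[of "col M j" i] M col_dim[of M j] by auto
qed

lemma matrix_null_homotopy:
  assumes k: "\<And>i. k i \<in> carrier_mat (n i) (n i)" "\<And>i. \<phi> i * k (Suc i) = k i * \<phi> i"
    and k0: "k 0 = 0\<^sub>m (n 0) (n 0)"
  obtains h where "\<And>i. h i \<in> carrier_mat (n (Suc i)) (n i)" "h 0 = 0\<^sub>m (n (Suc 0)) (n 0)"
    "\<And>i. k (Suc i) = \<phi> (Suc i) * h (Suc i) + h i * \<phi> i"
proof -
  note c = matrix_resolution_carrier
  \<comment> \<open>By the second conjunct and the chain map equation,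
    \<open>k (Suc i) - h * \<phi> i\<close> is annihilated by \<open>\<phi> i\<close> and lifts
    along \<open>\<phi> (Suc i)\<close>. The value \<open>h 0 = 0\<close> is recorded because the
    vanishing argument relies on it at the first place.\<close>
  define P where "P i h \<longleftrightarrow> h \<in> carrier_mat (n (Suc i)) (n i) \<and> \<phi> i * (h * \<phi> i) = k i * \<phi> i
    \<and> (i = 0 \<longrightarrow> h = 0\<^sub>m (n (Suc 0)) (n 0))" for i h
  have "\<exists>h. \<forall>i. P i (h i) \<and> k (Suc i) = \<phi> (Suc i) * h (Suc i) + h i * \<phi> i"
  proof (rule dependent_nat_choice)
    have "P 0 (0\<^sub>m (n (Suc 0)) (n 0))"
      using c[of 0] k0 by (simp add: P_def)
    then show "\<exists>h. P 0 h" ..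
  next
    fix h i assume "P i h"
    then have h: "h \<in> carrier_mat (n (Suc i)) (n i)" "\<phi> i * (h * \<phi> i) = k i * \<phi> i"
      by (auto simp: P_def)
    have hp: "h * \<phi> i \<in> carrier_mat (n (Suc i)) (n (Suc i))" using h c[of i] by simp
    have d: "k (Suc i) - h * \<phi> i \<in> carrier_mat (n (Suc i)) (n (Suc i))"
      using hp by (rule minus_carrier_mat)
    have "\<phi> i * (k (Suc i) - h * \<phi> i) = \<phi> i * k (Suc i) - \<phi> i * (h * \<phi> i)"
      using mult_minus_distrib_mat[OF c[of i] k(1)[of "Suc i"] hp] .
    also have "\<dots> = 0\<^sub>m (n i) (n (Suc i))"
      using h k(1)[of i] k(2)[of i] c[of i] by (simp add: minus_r_inv_mat[of _ "n i" "n (Suc i)"])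
    finally obtain h' where h': "h' \<in> carrier_mat (n (Suc (Suc i))) (n (Suc i))"
        "\<phi> (Suc i) * h' = k (Suc i) - h * \<phi> i"
      using matrix_resolution_lift[OF d] by blast
    have kk: "k (Suc i) = \<phi> (Suc i) * h' + h * \<phi> i"
      unfolding h' using k(1)[of "Suc i"] hp by (intro eq_matI) auto
    have "\<phi> (Suc i) * (h' * \<phi> (Suc i)) = (k (Suc i) - h * \<phi> i) * \<phi> (Suc i)"
      using assoc_mult_mat[OF c[of "Suc i"] h'(1) c[of "Suc i"]] h'(2) by simp
    also have "\<dots> = k (Suc i) * \<phi> (Suc i) - h * (\<phi> i * \<phi> (Suc i))"
      using minus_mult_distrib_mat[OF k(1)[of "Suc i"] hp c[of "Suc i"]]
        assoc_mult_mat[OF h(1) c[of i] c[of "Suc i"]] by simp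
    also have "\<dots> = k (Suc i) * \<phi> (Suc i)"
      using matrix_resolution_comp[of i] h(1) k(1)[of "Suc i"] c[of "Suc i"] by auto
    finally have "P (Suc i) h'" using h' by (simp add: P_def)
    with kk show "\<exists>h'. P (Suc i) h' \<and> k (Suc i) = \<phi> (Suc i) * h' + h * \<phi> i" by blast
  qed
  then obtain h where h: "\<And>i. P i (h i)" "\<And>i. k (Suc i) = \<phi> (Suc i) * h (Suc i) + h i * \<phi> i"
    by blast
  show ?thesis
    by (rule that[of h]) (use h in \<open>auto simp: P_def\<close>)
qed

end

text \<open>The comparison map over the identity at place 0: inclusion of the images gives the first
  lift, exactness of the target all later ones.\<close>

lemma matrix_chain_map:
  fixes \<phi> \<psi> :: "nat \<Rightarrow> 'r::comm_ring_1 mat"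
  assumes res: "matrix_resolution n \<phi>" "matrix_resolution m \<psi>" and 0: "n 0 = m 0"
    and img: "(\<lambda>w. \<phi> 0 *\<^sub>v w) ` carrier_vec (n 1) \<subseteq> (\<lambda>w. \<psi> 0 *\<^sub>v w) ` carrier_vec (m 1)"
  obtains f where "\<And>i. f i \<in> carrier_mat (m i) (n i)" "\<And>i. \<psi> i * f (Suc i) = f i * \<phi> i"
    "f 0 = 1\<^sub>m (n 0)"
proof -
  note c = matrix_resolution_carrier[OF res(1)]
  note c' = matrix_resolution_carrier[OF res(2)]
  obtain f1 where f1: "f1 \<in> carrier_mat (m 1) (n 1)" "\<psi> 0 * f1 = \<phi> 0"
  proof (rule matrix_lift)
    show "\<phi> 0 \<in> carrier_mat (m 0) (n 1)" "\<psi> 0 \<in> carrier_mat (m 0) (m 1)"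
      using c[of 0] c'[of 0] 0 by simp_all
    fix j assume j: "j < n 1"
    have "col (\<phi> 0) j = \<phi> 0 *\<^sub>v unit_vec (n 1) j"
      using c[of 0] j by (simp add: mult_mat_unit_vec)
    then show "col (\<phi> 0) j \<in> (\<lambda>w. \<psi> 0 *\<^sub>v w) ` carrier_vec (m 1)"
      using img by (metis imageI subsetD unit_vec_carrier)
  qed
  \<comment> \<open>A pair of consecutive components is carried along, because the commutation
    relation links them and the next lift depends on it.\<close>
  define P where "P i f \<longleftrightarrow> fst f \<in> carrier_mat (m i) (n i) \<and> snd f \<in> carrier_mat (m (Suc i)) (n (Suc i))
    \<and> \<psi> i * snd f = fst f * \<phi> i \<and> (i = 0 \<longrightarrow> fst f = 1\<^sub>m (n 0))" for i and f :: "'r mat \<times> 'r mat"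
  have "\<exists>f. \<forall>i. P i (f i) \<and> fst (f (Suc i)) = snd (f i)"
  proof (rule dependent_nat_choice)
    show "\<exists>f. P 0 f"
      using f1 c[of 0] 0 by (intro exI[of _ "(1\<^sub>m (n 0), f1)"]) (simp add: P_def)
  next
    fix f i assume f: "P i f"
    have d: "snd f * \<phi> (Suc i) \<in> carrier_mat (m (Suc i)) (n (Suc (Suc i)))"
      using f c[of "Suc i"] by (auto simp: P_def)
    have "\<psi> i * (snd f * \<phi> (Suc i)) = \<psi> i * snd f * \<phi> (Suc i)"
      using f c[of "Suc i"] c'[of i] by (intro assoc_mult_mat[symmetric]) (auto simp: P_def)
    also have "\<dots> = fst f * (\<phi> i * \<phi> (Suc i))"
      using f assoc_mult_mat[of "fst f" "m i" "n i" "\<phi> i" _ "\<phi> (Suc i)"] c[of i] c[of "Suc i"]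
      by (auto simp: P_def)
    also have "\<dots> = 0\<^sub>m (m i) (n (Suc (Suc i)))"
      unfolding matrix_resolution_comp[OF res(1)]
      using f by (intro right_mult_zero_mat) (simp add: P_def)
    finally obtain g where "g \<in> carrier_mat (m (Suc (Suc i))) (n (Suc (Suc i)))"
        "\<psi> (Suc i) * g = snd f * \<phi> (Suc i)"
      using matrix_resolution_lift[OF res(2) d] by blast
    then show "\<exists>g. P (Suc i) g \<and> fst g = snd f"
      using f by (intro exI[of _ "(snd f, g)"]) (simp add: P_def)
  qed
  then obtain F where F: "\<And>i. P i (F i)" "\<And>i. fst (F (Suc i)) = snd (F i)" by blast
  show ?thesis
    by (rule that[of "\<lambda>i. fst (F i)"]) (use F in \<open>auto simp: P_def\<close>)
qed

text \<open>The identity of a minimal resolution is homotopic to a composite through the other resolution;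
  where the latter vanishes, applying the residue map \<open>c\<close> to the homotopy turns the identity into 0.\<close>

lemma minimal_matrix_resolution_vanishes:
  fixes \<phi> \<psi> :: "nat \<Rightarrow> 'r::comm_ring_1 mat" and c :: "'r \<Rightarrow> 's::comm_ring_1"
  assumes res: "matrix_resolution n \<phi>" "matrix_resolution m \<psi>" and 0: "n 0 = m 0"
    and img: "(\<lambda>w. \<phi> 0 *\<^sub>v w) ` carrier_vec (n 1) = (\<lambda>w. \<psi> 0 *\<^sub>v w) ` carrier_vec (m 1)"
    and hom: "\<And>x y. c (x + y) = c x + c y" "\<And>x y. c (x * y) = c x * c y" "c 1 = 1"
    and min: "\<And>i j k. j < n (Suc i) \<Longrightarrow> k < n (Suc (Suc i)) \<Longrightarrow> c (\<phi> (Suc i) $$ (j, k)) = 0"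
    and m: "m (Suc i) = 0"
  shows "n (Suc i) = 0"
proof (rule ccontr)
  assume n: "n (Suc i) \<noteq> 0"
  note C = matrix_resolution_carrier[OF res(1)]
  note C' = matrix_resolution_carrier[OF res(2)]
  obtain f where f: "\<And>i. f i \<in> carrier_mat (m i) (n i)" "\<And>i. \<psi> i * f (Suc i) = f i * \<phi> i"
      "f 0 = 1\<^sub>m (n 0)"
    using matrix_chain_map[OF res 0 equalityD1[OF img]] by blast
  obtain g where g: "\<And>i. g i \<in> carrier_mat (n i) (m i)" "\<And>i. \<phi> i * g (Suc i) = g i * \<psi> i"
      "g 0 = 1\<^sub>m (m 0)"
    using matrix_chain_map[OF res(2,1) 0[symmetric] equalityD2[OF img]] by blast
  define k where "k i = 1\<^sub>m (n i) - g i * f i" for i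
  have gf: "g i * f i \<in> carrier_mat (n i) (n i)" for i using f(1)[of i] g(1)[of i] by simp
  have k: "k i \<in> carrier_mat (n i) (n i)" for i unfolding k_def using gf by (rule minus_carrier_mat)
  have comm: "\<phi> i * k (Suc i) = k i * \<phi> i" for i
  proof -
    have "\<phi> i * k (Suc i) = \<phi> i - \<phi> i * (g (Suc i) * f (Suc i))"
      unfolding k_def using mult_minus_distrib_mat[OF C[of i] one_carrier_mat gf[of "Suc i"]] C[of i]
      by simp
    also have "\<phi> i * (g (Suc i) * f (Suc i)) = g i * f i * \<phi> i"
      using assoc_mult_mat[OF C[of i] g(1)[of "Suc i"] f(1)[of "Suc i"]]
        assoc_mult_mat[OF g(1)[of i] C'[of i] f(1)[of "Suc i"]]
        assoc_mult_mat[OF g(1)[of i] f(1)[of i] C[of i]] f(2)[of i] g(2)[of i] by simp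
    also have "\<phi> i - g i * f i * \<phi> i = k i * \<phi> i"
      unfolding k_def using minus_mult_distrib_mat[OF one_carrier_mat gf[of i] C[of i]] C[of i]
      by simp
    finally show ?thesis .
  qed
  have "k 0 = 0\<^sub>m (n 0) (n 0)"
    using f(3) g(3) 0 by (simp add: k_def)
  from matrix_null_homotopy[OF res(1) k comm this]
  obtain h where h: "\<And>i. h i \<in> carrier_mat (n (Suc i)) (n i)" "h 0 = 0\<^sub>m (n (Suc 0)) (n 0)"
    "\<And>i. k (Suc i) = \<phi> (Suc i) * h (Suc i) + h i * \<phi> i" by blast
  have c0: "c 0 = 0" using hom(1)[of 0 0] by simp
  have csum: "c (sum F S) = (\<Sum>x\<in>S. c (F x))" for F and S :: "nat set"
    by (induction S rule: infinite_finite_induct) (auto simp: c0 hom)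
  \<comment> \<open>The composite passes through a module of rank \<open>m (Suc i) = 0\<close>, so
    at this place the homotopy connects the identity with 0.\<close>
  have "g (Suc i) * f (Suc i) = 0\<^sub>m (n (Suc i)) (n (Suc i))"
    using f(1)[of "Suc i"] g(1)[of "Suc i"] m by (intro eq_matI) (auto simp: scalar_prod_def)
  then have "k (Suc i) = 1\<^sub>m (n (Suc i))"
    unfolding k_def by (intro eq_matI) auto
  then have "1 = (\<phi> (Suc i) * h (Suc i) + h i * \<phi> i) $$ (0, 0)"
    using h(3)[of i] n by simp
  also have "\<dots> = (\<phi> (Suc i) * h (Suc i)) $$ (0, 0) + (h i * \<phi> i) $$ (0, 0)"
    using n h(1)[of i] C[of i] by simp
  finally have "(1 :: 'r) = (\<phi> (Suc i) * h (Suc i)) $$ (0, 0) + (h i * \<phi> i) $$ (0, 0)" .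
  from arg_cong[OF this, of c] have "c 1 = c ((\<phi> (Suc i) * h (Suc i)) $$ (0, 0)) + c ((h i * \<phi> i) $$ (0, 0))"
    by (simp only: hom(1))
  moreover have "c ((\<phi> (Suc i) * h (Suc i)) $$ (0, 0)) = 0"
    using C[of "Suc i"] h(1)[of "Suc i"] n by (auto simp: scalar_prod_def csum hom min)
  moreover have "c ((h i * \<phi> i) $$ (0, 0)) = 0"
  \<comment> \<open>Minimality says nothing about the entries of \<open>\<phi> 0\<close>; for
    \<open>i = 0\<close> the term vanishes by \<open>h 0 = 0\<close> instead.\<close>
  proof (cases i)
    case 0
    then show ?thesis using h(2) C[of 0] n by (auto simp: c0)
  next
    case (Suc j)
    then show ?thesis using C[of i] h(1)[of i] n by (auto simp: scalar_prod_def csum hom min)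
  qed
  ultimately show False by (simp add: hom)
qed

section \<open>Monomials and Stanley--Reisner ideals\<close>

definition sqmon :: "'n::finite set \<Rightarrow> 'n \<Rightarrow>\<^sub>0 nat" where
  "sqmon A = (\<Sum>i\<in>A. Poly_Mapping.single i 1)"

lemma lookup_sqmon: "lookup (sqmon A) i = (if i \<in> A then 1 else 0)"
  by (simp add: sqmon_def lookup_sum lookup_single when_def)

lemma keys_sqmon [simp]: "keys (sqmon A) = A"
  by (auto simp: in_keys_iff lookup_sqmon split: if_splits)

lemma keys_add_nat: "keys (s + t :: 'n \<Rightarrow>\<^sub>0 nat) = keys s \<union> keys t"
  by (auto simp: in_keys_iff lookup_add)

lemma diff_sqmon_add: "A \<subseteq> keys t \<Longrightarrow> (t - sqmon A) + sqmon A = t"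
  by (rule poly_mapping_eqI) (force simp: lookup_add lookup_minus lookup_sqmon in_keys_iff)

lemma lookup_single_mult:
  fixes s :: "'n \<Rightarrow>\<^sub>0 nat" and p :: "('n \<Rightarrow>\<^sub>0 nat) \<Rightarrow>\<^sub>0 'k::field"
  shows "lookup (Poly_Mapping.single s c * p) u = (\<Sum>q. c * lookup p q when u = s + q)"
proof -
  have "lookup (Poly_Mapping.single s c * p) u
      = (\<Sum>l. (c when s = l) * (\<Sum>q. lookup p q when u = l + q))"
    by (simp add: lookup_mult lookup_single)
  also have "\<dots> = (\<Sum>l. c * (\<Sum>q. lookup p q when u = l + q) when s = l)"
    by (simp add: when_mult)
  also have "\<dots> = c * (\<Sum>q. lookup p q when u = s + q)"
    by (rule Sum_any_when_equal')
  also have "\<dots> = (\<Sum>q. c * lookup p q when u = s + q)"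
  proof (cases "\<exists>q. u = s + q")
    case True
    then obtain q0 where "u = s + q0" ..
    then have "u = s + q \<longleftrightarrow> q0 = q" for q by auto
    then show ?thesis by simp
  next
    case False
    then show ?thesis by simp
  qed
  finally show ?thesis .
qed

lemma lookup_single_mult_add:
  fixes s :: "'n \<Rightarrow>\<^sub>0 nat" and p :: "('n \<Rightarrow>\<^sub>0 nat) \<Rightarrow>\<^sub>0 'k::field"
  shows "lookup (Poly_Mapping.single s c * p) (s + u) = c * lookup p u"
  by (simp add: lookup_single_mult)

lemma lookup_single_mult_eq_0:
  fixes s :: "'n \<Rightarrow>\<^sub>0 nat" and p :: "('n \<Rightarrow>\<^sub>0 nat) \<Rightarrow>\<^sub>0 'k::field"
  assumes "\<And>q. u \<noteq> s + q"
  shows "lookup (Poly_Mapping.single s c * p) u = 0"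
  using assms by (simp add: lookup_single_mult)

text \<open>Together with additivity this makes the constant coefficient a ring homomorphism, the
  residue map of S at the irrelevant ideal. The exponent 0 arises only as 0 + 0, so terms of
  positive degree do not contribute.\<close>

lemma lookup_mult_0:
  fixes p q :: "('n \<Rightarrow>\<^sub>0 nat) \<Rightarrow>\<^sub>0 'k::field"
  shows "lookup (p * q) 0 = lookup p 0 * lookup q 0"
proof -
  define p' where "p' = p - Poly_Mapping.single 0 (lookup p 0)"
  have "0 \<notin> keys (p' * q)"
  proof
    assume "0 \<in> keys (p' * q)"
    then obtain a b where "a \<in> keys p'" "0 = a + b" using keys_mult[of p' q] by auto
    then have "a = 0"
      by (intro poly_mapping_eqI) (metis add_is_0 lookup_add lookup_zero)
    then show False using \<open>a \<in> keys p'\<close> by (simp add: p'_def in_keys_iff lookup_minus)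
  qed
  moreover have "p * q = Poly_Mapping.single 0 (lookup p 0) * q + p' * q"
    by (simp add: p'_def algebra_simps)
  moreover have "lookup (Poly_Mapping.single 0 (lookup p 0) * q) 0 = lookup p 0 * lookup q 0"
    using lookup_single_mult_add[of 0 "lookup p 0" q 0] by simp
  ultimately show ?thesis by (simp add: lookup_add in_keys_iff)
qed

lemma module_mult: "Modules.module ((*) :: 'r::comm_ring_1 \<Rightarrow> 'r \<Rightarrow> 'r)"
  by unfold_locales (simp_all add: algebra_simps)

lemma sum_monomials:
  "(\<Sum>t\<in>keys p. Poly_Mapping.single t (lookup p t)) = (p :: 'a \<Rightarrow>\<^sub>0 'b::comm_monoid_add)"
  by (rule poly_mapping_eqI) (auto simp: lookup_sum lookup_single when_def in_keys_iff)

lemma prod_var: "(\<Prod>i\<in>A. var i) = (Poly_Mapping.single (sqmon A) 1 :: ('n::finite, 'k::field) mpoly)"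
proof -
  have "finite A" by simp
  then show ?thesis
  proof (induction A rule: finite_induct)
    case (insert i A)
    then show ?case by (simp add: sqmon_def var_def mult_single)
  qed (simp add: sqmon_def)
qed

text \<open>Nonfaces are closed under supersets, so the polynomials whose terms have nonface
  supports form an ideal; conversely each such term is a multiple of the squarefree monomial on its
  own support.\<close>

lemma stanley_reisner_ideal_iff:
  assumes "abstract_simplicial_complex X"
  shows "(p :: ('n::finite, 'k::field) mpoly) \<in> stanley_reisner_ideal X \<longleftrightarrow> (\<forall>t\<in>keys p. keys t \<notin> X)"
proof
  interpret Modules.module "(*) :: ('n, 'k) mpoly \<Rightarrow> _" by (rule module_mult)
  let ?M = "{p :: ('n, 'k) mpoly. \<forall>t\<in>keys p. keys t \<notin> X}"
  let ?G = "{(\<Prod>i\<in>A. var i) |A. A \<notin> X} :: ('n, 'k) mpoly set"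
  {
    have "span ?G \<subseteq> ?M"
    proof (rule span_minimal)
      show "?G \<subseteq> ?M" by (auto simp: prod_var)
      show "subspace ?M"
      proof (rule subspaceI)
        show "0 \<in> ?M" by simp
        show "p + q \<in> ?M" if "p \<in> ?M" "q \<in> ?M" for p q
          using that keys_add[of p q] by auto
        show "c * p \<in> ?M" if p: "p \<in> ?M" for c p
        proof safe
          fix t assume "t \<in> keys (c * p)" "keys t \<in> X"
          then obtain a b where "b \<in> keys p" "t = a + b" using keys_mult[of c p] by auto
          then have "keys b \<subseteq> keys t" by (simp add: keys_add_nat)
          then show False
            using \<open>b \<in> keys p\<close> \<open>keys t \<in> X\<close> p assms unfolding abstract_simplicial_complex_def by blast
        qed
      qed
    qed
    moreover assume "p \<in> stanley_reisner_ideal X"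
    ultimately show "\<forall>t\<in>keys p. keys t \<notin> X"
      by (auto simp: stanley_reisner_ideal_def ideal_gen_def)
  }
  assume p: "\<forall>t\<in>keys p. keys t \<notin> X"
  have "(\<Sum>t\<in>keys p. Poly_Mapping.single t (lookup p t)) \<in> span ?G"
  proof (rule span_sum)
    fix t assume "t \<in> keys p"
    then have "Poly_Mapping.single (sqmon (keys t)) 1 \<in> span ?G"
      using p by (intro span_base) (auto simp: prod_var)
    then have "Poly_Mapping.single (t - sqmon (keys t)) (lookup p t) * Poly_Mapping.single (sqmon (keys t)) 1 \<in> span ?G"
      by (rule span_scale)
    then show "Poly_Mapping.single t (lookup p t) \<in> span ?G"
      by (simp add: mult_single diff_sqmon_add)
  qed
  then show "p \<in> stanley_reisner_ideal X"
    by (simp add: sum_monomials stanley_reisner_ideal_def ideal_gen_def)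
qed

lemma lookup_0_irrelevant_ideal:
  assumes "(p :: ('n::finite, 'k::field) mpoly) \<in> ideal_gen (range var)"
  shows "lookup p 0 = 0"
proof -
  interpret Modules.module "(*) :: ('n, 'k) mpoly \<Rightarrow> _" by (rule module_mult)
  have "span (range var) \<subseteq> {p :: ('n, 'k) mpoly. lookup p 0 = 0}"
  proof (rule span_minimal)
    have "Poly_Mapping.single i (1 :: nat) \<noteq> 0" for i :: 'n
      by (metis lookup_single_eq lookup_zero one_neq_zero)
    then show "range var \<subseteq> {p :: ('n, 'k) mpoly. lookup p 0 = 0}"
      by (auto simp: var_def lookup_single)
    show "subspace {p :: ('n, 'k) mpoly. lookup p 0 = 0}"
      by (rule subspaceI) (auto simp: lookup_add lookup_mult_0)
  qed
  then show ?thesis using assms by (auto simp: ideal_gen_def)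
qed

lemma single_in_irrelevant_ideal:
  assumes "t \<noteq> 0"
  shows "(Poly_Mapping.single t c :: ('n::finite, 'k::field) mpoly) \<in> ideal_gen (range var)"
proof -
  interpret Modules.module "(*) :: ('n, 'k) mpoly \<Rightarrow> _" by (rule module_mult)
  obtain i where "i \<in> keys t" using assms by (metis equals0I keys_eq_empty)
  then have "t - Poly_Mapping.single i 1 + Poly_Mapping.single i 1 = t"
    using diff_sqmon_add[of "{i}" t] by (simp add: sqmon_def)
  then have "Poly_Mapping.single t c = Poly_Mapping.single (t - Poly_Mapping.single i 1) c * (var i :: ('n, 'k) mpoly)"
    by (simp add: var_def mult_single)
  then show ?thesis
    unfolding ideal_gen_def by (simp only:) (intro span_scale span_base rangeI)
qed

section \<open>From strands to modules over the polynomial ring\<close>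

context squarefree_resolution
begin

text \<open>Homogenization of the scalar differential: at a nonzero coefficient the label of the
  target is contained in that of the source, and the monomial is the quotient of the two squarefree
  monomials. Rows belong to the targets \<open>cs\<close>, columns to the sources
  \<open>bs\<close>.\<close>

definition diff_mat :: "'a list \<Rightarrow> 'a list \<Rightarrow> ('n, 'k) mpoly mat" where
  "diff_mat cs bs = mat (length cs) (length bs)
     (\<lambda>(j, k). Poly_Mapping.single (sqmon (L (bs ! k) - L (cs ! j))) (lookup (D (bs ! k)) (cs ! j)))"

text \<open>The component of the vector \<open>v\<close> in multidegree \<open>t\<close>, an element of the strand of the support
  of \<open>t\<close>.\<close>

definition component :: "'a list \<Rightarrow> ('n, 'k) mpoly vec \<Rightarrow> ('n \<Rightarrow>\<^sub>0 nat) \<Rightarrow> 'a \<Rightarrow>\<^sub>0 'k" where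
  "component bs v t = (\<Sum>k<length bs. Poly_Mapping.single (bs ! k)
     (if L (bs ! k) \<subseteq> keys t then lookup (v $ k) (t - sqmon (L (bs ! k))) else 0))"

lemma lookup_component:
  assumes "distinct bs" "k < length bs"
  shows "lookup (component bs v t) (bs ! k)
    = (if L (bs ! k) \<subseteq> keys t then lookup (v $ k) (t - sqmon (L (bs ! k))) else 0)" (is "_ = ?c k")
proof -
  have "lookup (component bs v t) (bs ! k) = (\<Sum>j<length bs. if j = k then ?c j else 0)"
    unfolding component_def lookup_sum using assms
    by (intro sum.cong) (auto simp: lookup_single when_def nth_eq_iff_index_eq)
  then show ?thesis using assms by simp
qed

lemma lookup_component_notin: "b \<notin> set bs \<Longrightarrow> lookup (component bs v t) b = 0"
  unfolding component_def lookup_sum by (intro sum.neutral) (auto simp: lookup_single when_def)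

lemma keys_component:
  assumes "distinct bs"
  shows "keys (component bs v t) \<subseteq> {b\<in>set bs. L b \<subseteq> keys t}"
proof
  fix b assume b: "b \<in> keys (component bs v t)"
  then have "b \<in> set bs" using lookup_component_notin by (auto simp: in_keys_iff)
  then obtain k where "k < length bs" "b = bs ! k" by (metis in_set_conv_nth)
  then show "b \<in> {b\<in>set bs. L b \<subseteq> keys t}"
    using b lookup_component[OF assms, of k v t] by (auto simp: in_keys_iff split: if_splits)
qed

text \<open>The coefficient of \<open>u\<close> in entry \<open>k\<close> reappears in multidegree
  \<open>u + sqmon (L (bs ! k))\<close>, so no coefficient is lost.\<close>

lemma component_inject:
  assumes "distinct bs" "v \<in> carrier_vec (length bs)" "w \<in> carrier_vec (length bs)"
    and eq: "\<And>t. component bs v t = component bs w t"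
  shows "v = w"
proof (rule eq_vecI)
  fix k assume "k < dim_vec w"
  then have k: "k < length bs" using assms by simp
  show "v $ k = w $ k"
  proof (rule poly_mapping_eqI)
    fix u
    let ?t = "u + sqmon (L (bs ! k))"
    have "L (bs ! k) \<subseteq> keys ?t" by (simp add: keys_add_nat)
    then show "lookup (v $ k) u = lookup (w $ k) u"
      using eq[of ?t] lookup_component[OF assms(1) k, of v ?t] lookup_component[OF assms(1) k, of w ?t]
      by simp
  qed
qed (use assms in simp)

lemma finite_component: "finite {t. component bs v t \<noteq> 0}"
proof (rule finite_subset)
  show "{t. component bs v t \<noteq> 0}
      \<subseteq> (\<Union>k<length bs. (\<lambda>u. u + sqmon (L (bs ! k))) ` keys (v $ k))"
  proof
    fix t assume "t \<in> {t. component bs v t \<noteq> 0}"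
    then obtain k where "k \<in> {..<length bs}" "Poly_Mapping.single (bs ! k)
        (if L (bs ! k) \<subseteq> keys t then lookup (v $ k) (t - sqmon (L (bs ! k))) else 0) \<noteq> 0"
      unfolding component_def mem_Collect_eq by (rule sum.not_neutral_contains_not_neutral)
    then have k: "k < length bs" "L (bs ! k) \<subseteq> keys t"
        "lookup (v $ k) (t - sqmon (L (bs ! k))) \<noteq> 0"
      by (auto split: if_splits)
    then have "t \<in> (\<lambda>u. u + sqmon (L (bs ! k))) ` keys (v $ k)"
      by (intro image_eqI[of _ _ "t - sqmon (L (bs ! k))"]) (simp_all add: diff_sqmon_add in_keys_iff)
    then show "t \<in> (\<Union>k<length bs. (\<lambda>u. u + sqmon (L (bs ! k))) ` keys (v $ k))"
      using k by blast
  qed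
qed simp

text \<open>Finitely many nonzero strand vectors assemble into a vector of polynomials. With
  \<open>component_inject\<close> this identifies the free module with the direct sum of its strands
  over all multidegrees.\<close>

lemma component_surj:
  assumes bs: "distinct bs" and W: "\<And>t. keys (W t) \<subseteq> {b\<in>set bs. L b \<subseteq> keys t}"
    and fin: "finite {t. W t \<noteq> 0}"
  obtains v where "v \<in> carrier_vec (length bs)" "\<And>t. component bs v t = W t"
proof
  define v where "v = vec (length bs)
    (\<lambda>k. \<Sum>t | W t \<noteq> 0. Poly_Mapping.single (t - sqmon (L (bs ! k))) (lookup (W t) (bs ! k)))"
  show "v \<in> carrier_vec (length bs)" by (simp add: v_def)
  fix t
  show "component bs v t = W t"
  proof (rule poly_mapping_eqI)
    fix b
    show "lookup (component bs v t) b = lookup (W t) b"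
    proof (cases "b \<in> set bs")
      case False
      then show ?thesis using W[of t] by (auto simp: lookup_component_notin in_keys_iff)
    next
      case True
      then obtain k where k: "k < length bs" "b = bs ! k" by (metis in_set_conv_nth)
      show ?thesis
      proof (cases "L b \<subseteq> keys t")
        case False
        then have "lookup (W t) b = 0" using W[of t] by (auto simp: in_keys_iff)
        then show ?thesis using False k lookup_component[OF bs k(1), of v t] by simp
      next
        case True
        have "lookup (component bs v t) b = lookup (v $ k) (t - sqmon (L b))"
          using True k lookup_component[OF bs k(1), of v t] by simp
        also have "\<dots> = (\<Sum>s | W s \<noteq> 0. lookup (W s) b when s - sqmon (L b) = t - sqmon (L b))"
          using k by (simp add: v_def lookup_sum lookup_single)
        also have "\<dots> = (\<Sum>s | W s \<noteq> 0. if s = t then lookup (W t) b else 0)"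
        proof (intro sum.cong refl)
          fix s
          show "(lookup (W s) b when s - sqmon (L b) = t - sqmon (L b)) = (if s = t then lookup (W t) b else 0)"
          proof (cases "lookup (W s) b = 0")
            case False
            then have "L b \<subseteq> keys s" using W[of s] by (auto simp: in_keys_iff)
            \<comment> \<open>Truncated subtraction is injective here, since both exponents contain
              \<open>L b\<close> in their support.\<close>
            then have "s - sqmon (L b) = t - sqmon (L b) \<longleftrightarrow> s = t"
              using True by (metis diff_sqmon_add)
            then show ?thesis by (simp add: when_def)
          qed (auto simp: when_def)
        qed
        also have "\<dots> = lookup (W t) b" using fin by auto
        finally show ?thesis .
      qed
    qed
  qed
qed

text \<open>The monomial in an entry shifts exponents by exactly the difference of the two labels,
  so in each multidegree the matrix acts as the scalar differential. This carries exactness of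
  strands over to S.\<close>

lemma component_diff_mat:
  assumes bs: "distinct bs" and cs: "distinct cs" and v: "v \<in> carrier_vec (length bs)"
    and D: "\<And>b. b \<in> set bs \<Longrightarrow> keys (D b) \<subseteq> {c\<in>set cs. L c \<subseteq> L b}"
  shows "component cs (diff_mat cs bs *\<^sub>v v) t = lin D (component bs v t)"
proof (rule poly_mapping_eqI)
  fix x
  define c where "c k = (if L (bs ! k) \<subseteq> keys t then lookup (v $ k) (t - sqmon (L (bs ! k))) else 0)" for k
  have "lin D (component bs v t) = (\<Sum>k<length bs. scl (c k) (D (bs ! k)))"
    by (simp add: component_def lin_sum c_def)
  then have R: "lookup (lin D (component bs v t)) x = (\<Sum>k<length bs. c k * lookup (D (bs ! k)) x)"
    by (simp add: lookup_sum)
  show "lookup (component cs (diff_mat cs bs *\<^sub>v v) t) x = lookup (lin D (component bs v t)) x"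
  proof (cases "x \<in> set cs")
    case False
    have "lookup (D (bs ! k)) x = 0" if "k < length bs" for k
      using D[of "bs ! k"] that False by (auto simp: in_keys_iff)
    then show ?thesis using False R by (simp add: lookup_component_notin)
  next
    case True
    then obtain j where j: "j < length cs" "x = cs ! j" by (metis in_set_conv_nth)
    let ?u = "t - sqmon (L x)"
    have summand: "lookup (Poly_Mapping.single (sqmon (L (bs ! k) - L x)) (lookup (D (bs ! k)) x) * v $ k) ?u
        = c k * lookup (D (bs ! k)) x" if k: "k < length bs" and Lx: "L x \<subseteq> keys t" for k
    proof (cases "lookup (D (bs ! k)) x = 0")
      case True
      then show ?thesis by simp
    next
      case False
      then have sub: "L x \<subseteq> L (bs ! k)" using D[of "bs ! k"] k by (auto simp: in_keys_iff)
      show ?thesis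
      proof (cases "L (bs ! k) \<subseteq> keys t")
        case True
        then have "?u = sqmon (L (bs ! k) - L x) + (t - sqmon (L (bs ! k)))"
          using sub by (intro poly_mapping_eqI)
            (force simp: lookup_add lookup_minus lookup_sqmon in_keys_iff)
        then show ?thesis using True by (simp add: lookup_single_mult_add c_def)
      next
        case False
        \<comment> \<open>Such a variable divides the monomial of the entry, but its exponent in
          \<open>?u\<close> is 0, so the entry contributes nothing to this coefficient.\<close>
        then obtain i where i: "i \<in> L (bs ! k)" "lookup t i = 0"
          by (metis in_keys_iff subsetI)
        then have "i \<notin> L x" using Lx by (auto simp: in_keys_iff)
        then have "?u \<noteq> sqmon (L (bs ! k) - L x) + q" for q
          using i by (auto simp: poly_mapping_eq_iff fun_eq_iff lookup_add lookup_minus lookup_sqmon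
            intro!: exI[of _ i])
        then show ?thesis using False by (simp add: lookup_single_mult_eq_0 c_def)
      qed
    qed
    have L: "lookup (component cs (diff_mat cs bs *\<^sub>v v) t) x
      = (if L x \<subseteq> keys t then lookup ((diff_mat cs bs *\<^sub>v v) $ j) ?u else 0)"
      using lookup_component[OF cs j(1)] j by simp
    show ?thesis
    proof (cases "L x \<subseteq> keys t")
      case True
      have "(diff_mat cs bs *\<^sub>v v) $ j
          = (\<Sum>k<length bs. Poly_Mapping.single (sqmon (L (bs ! k) - L x)) (lookup (D (bs ! k)) x) * v $ k)"
        using j v by (auto simp: diff_mat_def scalar_prod_def atLeast0LessThan intro!: sum.cong)
      then show ?thesis using True by (simp add: L R lookup_sum summand)
    next
      case False
      have "c k * lookup (D (bs ! k)) x = 0" if "k < length bs" for k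
      proof (cases "x \<in> keys (D (bs ! k))")
        case True
        then have "\<not> L (bs ! k) \<subseteq> keys t" using D[of "bs ! k"] that False by auto
        then show ?thesis by (simp add: c_def)
      qed (simp add: in_keys_iff)
      then have "(\<Sum>k<length bs. c k * lookup (D (bs ! k)) x) = 0"
        by (intro sum.neutral ballI) simp
      then show ?thesis using False by (simp add: L R)
    qed
  qed
qed

lemma diff_mat_kernel:
  assumes as: "distinct as" "set as = {b\<in>B. deg b = Suc (Suc i)}"
    and bs: "distinct bs" "set bs = {b\<in>B. deg b = Suc i}"
    and cs: "distinct cs" "set cs = {b\<in>B. deg b = i}"
  shows "mat_kernel (diff_mat cs bs) = (\<lambda>w. diff_mat bs as *\<^sub>v w) ` carrier_vec (length as)"
proof -
  have D1: "keys (D b) \<subseteq> {c\<in>set cs. L c \<subseteq> L b}" if "b \<in> set bs" for b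
    using keys_D[of b] that bs cs by auto
  have D2: "keys (D b) \<subseteq> {c\<in>set bs. L c \<subseteq> L b}" if "b \<in> set as" for b
    using keys_D[of b] that bs as by auto
  have M: "diff_mat cs bs \<in> carrier_mat (length cs) (length bs)"
    and N: "diff_mat bs as \<in> carrier_mat (length bs) (length as)"
    by (simp_all add: diff_mat_def)
  have comp_0: "component cs (0\<^sub>v (length cs)) t = 0" for t
    unfolding component_def by (intro sum.neutral) simp
  show ?thesis
    unfolding mat_kernel[OF M]
  proof (intro equalityI subsetI)
    fix v assume "v \<in> {v. v \<in> carrier_vec (length bs) \<and> diff_mat cs bs *\<^sub>v v = 0\<^sub>v (length cs)}"
    then have v: "v \<in> carrier_vec (length bs)" "diff_mat cs bs *\<^sub>v v = 0\<^sub>v (length cs)" by auto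
    \<comment> \<open>Preimages are chosen separately in each multidegree. Prescribing
      \<open>w = 0\<close> where the component vanishes leaves finitely many nonzero choices, so
      that they assemble into a vector.\<close>
    have "\<exists>w. keys w \<subseteq> {b\<in>set as. L b \<subseteq> keys t} \<and> lin D w = component bs v t
        \<and> (component bs v t = 0 \<longrightarrow> w = 0)" for t
    proof (cases "component bs v t = 0")
      case True
      then show ?thesis by (intro exI[of _ 0]) auto
    next
      case False
      have "lin D (component bs v t) = 0"
        using component_diff_mat[OF bs(1) cs(1) v(1) D1, of t] v(2) comp_0 by simp
      moreover have "keys (component bs v t) \<subseteq> {b\<in>B. deg b = Suc i \<and> L b \<subseteq> keys t}"
        using keys_component[OF bs(1), of v t] bs(2) by auto
      ultimately obtain w where "keys w \<subseteq> {b\<in>B. deg b = Suc (Suc i) \<and> L b \<subseteq> keys t}"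
          "lin D w = component bs v t"
        using exact by blast
      then show ?thesis using False as(2) by (intro exI[of _ w]) auto
    qed
    then obtain W where W: "\<And>t. keys (W t) \<subseteq> {b\<in>set as. L b \<subseteq> keys t}"
        "\<And>t. lin D (W t) = component bs v t" "\<And>t. component bs v t = 0 \<Longrightarrow> W t = 0"
      using choice[of "\<lambda>t w. keys w \<subseteq> {b\<in>set as. L b \<subseteq> keys t} \<and> lin D w = component bs v t
        \<and> (component bs v t = 0 \<longrightarrow> w = 0)"] by blast
    have "finite {t. W t \<noteq> 0}"
      by (rule finite_subset[OF _ finite_component[of bs v]]) (use W(3) in auto)
    then obtain w where w: "w \<in> carrier_vec (length as)" "\<And>t. component as w t = W t"
      using component_surj[OF as(1) W(1)] by blast
    have "diff_mat bs as *\<^sub>v w = v"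
    proof (rule component_inject[OF bs(1) _ v(1)])
      show "diff_mat bs as *\<^sub>v w \<in> carrier_vec (length bs)"
        using N w(1) by (rule mult_mat_vec_carrier)
      show "component bs (diff_mat bs as *\<^sub>v w) t = component bs v t" for t
        using component_diff_mat[OF as(1) bs(1) w(1) D2, of t] w(2) W(2) by simp
    qed
    then show "v \<in> (\<lambda>w. diff_mat bs as *\<^sub>v w) ` carrier_vec (length as)" using w by blast
  next
    fix v assume "v \<in> (\<lambda>w. diff_mat bs as *\<^sub>v w) ` carrier_vec (length as)"
    then obtain w where w: "w \<in> carrier_vec (length as)" and v: "v = diff_mat bs as *\<^sub>v w" by blast
    have vc: "v \<in> carrier_vec (length bs)" unfolding v using N w by (rule mult_mat_vec_carrier)
    have "diff_mat cs bs *\<^sub>v v = 0\<^sub>v (length cs)"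
    proof (rule component_inject[OF cs(1)])
      show "diff_mat cs bs *\<^sub>v v \<in> carrier_vec (length cs)" using M vc by (rule mult_mat_vec_carrier)
      fix t
      have "component cs (diff_mat cs bs *\<^sub>v v) t = lin D (lin D (component as w t))"
        using component_diff_mat[OF bs(1) cs(1) vc D1, of t]
          component_diff_mat[OF as(1) bs(1) w D2, of t] by (simp add: v)
      also have "\<dots> = 0"
        unfolding lin_lin
        by (rule lin_eq_0) (use keys_component[OF as(1), of w t] as(2) D_D in auto)
      finally show "component cs (diff_mat cs bs *\<^sub>v v) t = component cs (0\<^sub>v (length cs)) t"
        by (simp add: comp_0)
    qed simp
    then show "v \<in> {v. v \<in> carrier_vec (length bs) \<and> diff_mat cs bs *\<^sub>v v = 0\<^sub>v (length cs)}"
      using vc by simp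
  qed
qed

text \<open>The root has the empty label, so the component at the root in multidegree
  \<open>t\<close> is the plain coefficient of \<open>t\<close>. Membership thus reduces to the root
  being a boundary in the strand of the support of \<open>t\<close>, which \<open>image\<close>
  decides.\<close>

lemma diff_mat_image:
  assumes X: "abstract_simplicial_complex X"
    and bs: "distinct bs" "set bs = {b\<in>B. deg b = 1}"
  shows "(\<lambda>v. row (diff_mat [r] bs) 0 \<bullet> v) ` carrier_vec (length bs)
    = (stanley_reisner_ideal X :: ('n, 'k) mpoly set)"
proof -
  have D1: "keys (D b) \<subseteq> {c\<in>set [r]. L c \<subseteq> L b}" if "b \<in> set bs" for b
    using keys_D[of b] that bs deg_0 by auto
  have comp_r: "component [r] (diff_mat [r] bs *\<^sub>v v) t
      = Poly_Mapping.single r (lookup (row (diff_mat [r] bs) 0 \<bullet> v) t)" for v t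
    by (simp add: component_def label_root sqmon_def diff_mat_def)
  show ?thesis
  proof (intro equalityI subsetI)
    fix p assume "p \<in> (\<lambda>v. row (diff_mat [r] bs) 0 \<bullet> v) ` carrier_vec (length bs)"
    then obtain v where v: "v \<in> carrier_vec (length bs)" and p: "p = row (diff_mat [r] bs) 0 \<bullet> v" by blast
    have "keys t \<notin> X" if "t \<in> keys p" for t
    proof -
      have "lin D (component bs v t) = Poly_Mapping.single r (lookup p t)"
        using comp_r[of v t] component_diff_mat[OF bs(1) _ v D1, of t] by (simp add: p)
      then have "lin D (component bs v t) \<noteq> 0"
        using that by (metis in_keys_iff lookup_single_eq lookup_zero)
      then obtain b where b: "b \<in> keys (component bs v t)" "D b \<noteq> 0"
        using lin_eq_0[of "component bs v t" D] by blast
      then have "b \<in> B" "deg b = 1" "L b \<subseteq> keys t"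
        using keys_component[OF bs(1), of v t] bs(2) by auto
      then show ?thesis using image[of "keys t"] b(2) by blast
    qed
    then show "p \<in> stanley_reisner_ideal X" by (simp add: stanley_reisner_ideal_iff[OF X])
  next
    fix p :: "('n, 'k) mpoly" assume "p \<in> stanley_reisner_ideal X"
    then have p: "keys t \<notin> X" if "t \<in> keys p" for t
      using that by (simp add: stanley_reisner_ideal_iff[OF X])
    have "\<exists>w. keys w \<subseteq> {b\<in>set bs. L b \<subseteq> keys t} \<and> lin D w = Poly_Mapping.single r (lookup p t)
        \<and> (lookup p t = 0 \<longrightarrow> w = 0)" for t
    proof (cases "lookup p t = 0")
      case True
      then show ?thesis by (intro exI[of _ 0]) auto
    next
      case False
      then have "keys t \<notin> X" using p by (simp add: in_keys_iff)
      then obtain u where u: "keys u \<subseteq> {b\<in>strand (keys t). deg b = 1}" "lin D u = unit r"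
        by (rule root_boundary)
      have "keys (scl (lookup p t) u) \<subseteq> {b\<in>set bs. L b \<subseteq> keys t}"
        using keys_scl[of "lookup p t" u] u(1) bs(2) by (auto simp: strand_def)
      then show ?thesis using False u(2) by (intro exI[of _ "scl (lookup p t) u"]) simp
    qed
    then obtain W where W: "\<And>t. keys (W t) \<subseteq> {b\<in>set bs. L b \<subseteq> keys t}"
        "\<And>t. lin D (W t) = Poly_Mapping.single r (lookup p t)" "\<And>t. lookup p t = 0 \<Longrightarrow> W t = 0"
      using choice[of "\<lambda>t w. keys w \<subseteq> {b\<in>set bs. L b \<subseteq> keys t}
        \<and> lin D w = Poly_Mapping.single r (lookup p t) \<and> (lookup p t = 0 \<longrightarrow> w = 0)"] by blast
    have "finite {t. W t \<noteq> 0}"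
      by (rule finite_subset[OF _ finite_keys[of p]]) (use W(3) in \<open>auto simp: in_keys_iff\<close>)
    then obtain v where v: "v \<in> carrier_vec (length bs)" "\<And>t. component bs v t = W t"
      using component_surj[OF bs(1) W(1)] by blast
    have "row (diff_mat [r] bs) 0 \<bullet> v = p"
    proof (rule poly_mapping_eqI)
      fix t
      have "Poly_Mapping.single r (lookup (row (diff_mat [r] bs) 0 \<bullet> v) t)
          = Poly_Mapping.single r (lookup p t)"
        using comp_r[of v t] component_diff_mat[OF bs(1) _ v(1) D1, of t] v(2) W(2) by simp
      then show "lookup (row (diff_mat [r] bs) 0 \<bullet> v) t = lookup p t"
        by (metis lookup_single_eq)
    qed
    then show "p \<in> (\<lambda>v. row (diff_mat [r] bs) 0 \<bullet> v) ` carrier_vec (length bs)" using v by blast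
  qed
qed

end

section \<open>Projective dimension\<close>

lemma homogeneous_single_sqmon:
  "homogeneous (int (card A)) (Poly_Mapping.single (sqmon A) c :: ('n::finite, 'k::field) mpoly)"
proof -
  have "(\<Sum>i\<in>UNIV. lookup (sqmon A) i) = card A"
    by (simp add: lookup_sqmon sum.If_cases)
  then show ?thesis by (simp add: homogeneous_def del: of_nat_sum)
qed

text \<open>A basis element \<open>b\<close> sits in standard degree \<open>card (L b)\<close>.
  Minimality is a conditional clause so that one construction serves both the minimal resolutions
  and the products, which need not be minimal.\<close>

lemma (in squarefree_resolution) graded_free_resolution_exists:
  assumes X: "abstract_simplicial_complex X"
  shows "\<exists>\<epsilon> d \<phi>. graded_free_resolution (stanley_reisner_ideal X :: ('n, 'k) mpoly set) \<epsilon> d \<phi> \<and>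
     (\<forall>i. d i = [] \<longleftrightarrow> {b\<in>B. deg b = Suc i} = {}) \<and>
     ((\<forall>b\<in>B. deg b \<ge> 2 \<longrightarrow> (\<forall>b'\<in>keys (D b). L b' \<noteq> L b)) \<longrightarrow>
        minimal_graded_free_resolution (stanley_reisner_ideal X) \<epsilon> d \<phi>)"
proof -
  have "\<forall>i. \<exists>xs. set xs = {b\<in>B. deg b = i} \<and> distinct xs"
    using finite_distinct_list[OF finite_deg] by blast
  from choice[OF this] obtain bs where bs: "\<And>i. set (bs i) = {b\<in>B. deg b = i}" "\<And>i. distinct (bs i)"
    by blast
  define d where "d i = map (\<lambda>b. int (card (L b))) (bs (Suc i))" for i
  define \<phi> where "\<phi> i = diff_mat (bs (Suc i)) (bs (Suc (Suc i)))" for i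
  define \<epsilon> where "\<epsilon> = row (diff_mat [r] (bs 1)) 0"
  have len: "length (d i) = length (bs (Suc i))" for i by (simp add: d_def)
  have nth_\<phi>: "\<phi> i $$ (j, k) = Poly_Mapping.single (sqmon (L (bs (Suc (Suc i)) ! k) - L (bs (Suc i) ! j)))
      (lookup (D (bs (Suc (Suc i)) ! k)) (bs (Suc i) ! j))"
    if "j < length (d i)" "k < length (d (Suc i))" for i j k
    using that by (simp add: \<phi>_def diff_mat_def len)
  have nth_bs: "bs i ! j \<in> B" "deg (bs i ! j) = i" if "j < length (bs i)" for i j
    using that bs(1)[of i] nth_mem by blast+
  have sub: "L (bs (Suc i) ! j) \<subseteq> L (bs (Suc (Suc i)) ! k)"
    if "j < length (d i)" "k < length (d (Suc i))" "lookup (D (bs (Suc (Suc i)) ! k)) (bs (Suc i) ! j) \<noteq> 0"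
    for i j k
    using keys_D[of "bs (Suc (Suc i)) ! k"] nth_bs(1)[of k "Suc (Suc i)"] that
    by (auto simp: len in_keys_iff)
  have M: "diff_mat [r] (bs 1) \<in> carrier_mat 1 (length (bs 1))" by (simp add: diff_mat_def)
  have res: "graded_free_resolution (stanley_reisner_ideal X) \<epsilon> d \<phi>"
    unfolding graded_free_resolution_def
  proof (intro conjI allI impI)
    show "\<epsilon> \<in> carrier_vec (length (d 0))" by (simp add: \<epsilon>_def len diff_mat_def)
    show "homogeneous (d 0 ! j) (\<epsilon> $ j)" if "j < length (d 0)" for j
      using that by (simp add: \<epsilon>_def d_def diff_mat_def label_root homogeneous_single_sqmon)
    show "\<phi> i \<in> carrier_mat (length (d i)) (length (d (Suc i)))" for i
      by (simp add: \<phi>_def len diff_mat_def)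
    show "homogeneous (d (Suc i) ! k - d i ! j) (\<phi> i $$ (j, k))"
      if jk: "j < length (d i)" "k < length (d (Suc i))" for i j k
    proof (cases "lookup (D (bs (Suc (Suc i)) ! k)) (bs (Suc i) ! j) = 0")
      case True
      then show ?thesis using jk by (simp add: nth_\<phi> homogeneous_def)
    next
      case False
      have "d (Suc i) ! k - d i ! j = int (card (L (bs (Suc (Suc i)) ! k) - L (bs (Suc i) ! j)))"
        using jk sub[OF jk False] by (simp add: d_def card_Diff_subset card_mono of_nat_diff)
      then show ?thesis using jk by (simp only: nth_\<phi> homogeneous_single_sqmon)
    qed
    show "(\<lambda>v. \<epsilon> \<bullet> v) ` carrier_vec (length (d 0)) = stanley_reisner_ideal X"
      using diff_mat_image[OF X bs(2) bs(1)] by (simp add: \<epsilon>_def len)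
    \<comment> \<open>Exactness at \<open>F 0\<close> is the kernel statement for the one-row matrix
      whose only target is the root.\<close>
    have "mat_kernel (diff_mat [r] (bs 1)) = (\<lambda>w. \<phi> 0 *\<^sub>v w) ` carrier_vec (length (d 1))"
      using diff_mat_kernel[of "bs 2" 0 "bs 1" "[r]"] bs deg_0 by (simp add: \<phi>_def len numeral_2_eq_2)
    moreover have "diff_mat [r] (bs 1) *\<^sub>v v = 0\<^sub>v 1 \<longleftrightarrow> \<epsilon> \<bullet> v = 0" for v
      using M by (auto simp: \<epsilon>_def vec_eq_iff)
    ultimately show "{v \<in> carrier_vec (length (d 0)). \<epsilon> \<bullet> v = 0} = (\<lambda>w. \<phi> 0 *\<^sub>v w) ` carrier_vec (length (d 1))"
      unfolding mat_kernel[OF M] by (simp add: len)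
    show "mat_kernel (\<phi> i) = (\<lambda>w. \<phi> (Suc i) *\<^sub>v w) ` carrier_vec (length (d (Suc (Suc i))))" for i
      unfolding \<phi>_def len using bs by (intro diff_mat_kernel) auto
  qed
  have "minimal_graded_free_resolution (stanley_reisner_ideal X) \<epsilon> d \<phi>"
    if min: "\<forall>b\<in>B. deg b \<ge> 2 \<longrightarrow> (\<forall>b'\<in>keys (D b). L b' \<noteq> L b)"
    unfolding minimal_graded_free_resolution_def
  proof (intro conjI allI impI res)
    interpret Modules.module "(*) :: ('n, 'k) mpoly \<Rightarrow> _" by (rule module_mult)
    fix i j k assume jk: "j < length (d i)" "k < length (d (Suc i))"
    let ?b = "bs (Suc (Suc i)) ! k" and ?b' = "bs (Suc i) ! j"
    show "\<phi> i $$ (j, k) \<in> ideal_gen (range var)"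
    proof (cases "lookup (D ?b) ?b' = 0")
      case True
      then show ?thesis using jk by (simp add: nth_\<phi> ideal_gen_def span_zero)
    next
      case False
      have "?b \<in> B" "deg ?b \<ge> 2" using nth_bs[of k "Suc (Suc i)"] jk by (auto simp: len)
      then have "L ?b' \<noteq> L ?b" using False min by (auto simp: in_keys_iff)
      then have "L ?b - L ?b' \<noteq> {}" using sub[OF jk False] by blast
      then have "sqmon (L ?b - L ?b') \<noteq> 0" by (metis keys_sqmon keys_zero)
      then show ?thesis unfolding nth_\<phi>[OF jk] by (rule single_in_irrelevant_ideal)
    qed
  qed
  moreover have "d i = [] \<longleftrightarrow> {b\<in>B. deg b = Suc i} = {}" for i
    unfolding bs(1)[symmetric] by (simp add: d_def)
  ultimately show ?thesis using res by blast
qed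

text \<open>Place 0 is the copy of S containing the ideal and the augmentation becomes map number 0,
  so a resolution of I turns into one of S/I with all indices raised by 1.\<close>

definition augmented_ranks :: "(nat \<Rightarrow> int list) \<Rightarrow> nat \<Rightarrow> nat" where
  "augmented_ranks d i = (case i of 0 \<Rightarrow> 1 | Suc i \<Rightarrow> length (d i))"

definition augmented_maps :: "'r vec \<Rightarrow> (nat \<Rightarrow> 'r mat) \<Rightarrow> nat \<Rightarrow> 'r mat" where
  "augmented_maps \<epsilon> \<phi> i = (case i of 0 \<Rightarrow> mat_of_row \<epsilon> | Suc i \<Rightarrow> \<phi> i)"

lemma mat_of_row_mult_vec: "mat_of_row \<epsilon> *\<^sub>v v = vec 1 (\<lambda>_. \<epsilon> \<bullet> v)"
  by (rule eq_vecI) auto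

lemma graded_free_resolution_matrix:
  assumes "graded_free_resolution I \<epsilon> d \<phi>"
  shows "matrix_resolution (augmented_ranks d) (augmented_maps \<epsilon> \<phi>)"
    and "(\<lambda>w. augmented_maps \<epsilon> \<phi> 0 *\<^sub>v w) ` carrier_vec (augmented_ranks d 1) = (\<lambda>p. vec 1 (\<lambda>_. p)) ` I"
proof -
  have \<epsilon>: "\<epsilon> \<in> carrier_vec (length (d 0))"
    and \<phi>: "\<And>i. \<phi> i \<in> carrier_mat (length (d i)) (length (d (Suc i)))"
    and img: "(\<lambda>v. \<epsilon> \<bullet> v) ` carrier_vec (length (d 0)) = I"
    and ker0: "{v \<in> carrier_vec (length (d 0)). \<epsilon> \<bullet> v = 0} = (\<lambda>w. \<phi> 0 *\<^sub>v w) ` carrier_vec (length (d 1))"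
    and ker: "\<And>i. mat_kernel (\<phi> i) = (\<lambda>w. \<phi> (Suc i) *\<^sub>v w) ` carrier_vec (length (d (Suc (Suc i))))"
    using assms unfolding graded_free_resolution_def by blast+
  have row: "mat_of_row \<epsilon> \<in> carrier_mat 1 (length (d 0))" using \<epsilon> by auto
  have "vec 1 (\<lambda>_. p) = 0\<^sub>v 1 \<longleftrightarrow> p = 0" for p :: "('a, 'b) mpoly"
    by (auto simp: vec_eq_iff)
  then have "mat_kernel (mat_of_row \<epsilon>) = (\<lambda>w. \<phi> 0 *\<^sub>v w) ` carrier_vec (length (d 1))"
    unfolding mat_kernel[OF row] ker0[symmetric] mat_of_row_mult_vec by auto
  then show "matrix_resolution (augmented_ranks d) (augmented_maps \<epsilon> \<phi>)"
    using row \<phi> ker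
    by (auto simp: matrix_resolution_def augmented_ranks_def augmented_maps_def split: nat.split)
  show "(\<lambda>w. augmented_maps \<epsilon> \<phi> 0 *\<^sub>v w) ` carrier_vec (augmented_ranks d 1) = (\<lambda>p. vec 1 (\<lambda>_. p)) ` I"
    unfolding img[symmetric] by (auto simp: augmented_ranks_def augmented_maps_def mat_of_row_mult_vec)
qed

text \<open>The comparison argument with the constant coefficient as residue map, which kills the
  differentials of a minimal resolution. It serves twice: between two minimal resolutions, making
  \<open>pd\<close> well defined, and against an arbitrary one, bounding \<open>pd\<close>.\<close>

lemma minimal_graded_free_resolution_vanishes:
  assumes min: "minimal_graded_free_resolution I \<epsilon> d \<phi>" and res: "graded_free_resolution I \<epsilon>' d' \<phi>'"
    and "d' i = []"
  shows "d i = []"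
proof -
  have res0: "graded_free_resolution I \<epsilon> d \<phi>"
    using min by (simp add: minimal_graded_free_resolution_def)
  note m = graded_free_resolution_matrix[OF res0] graded_free_resolution_matrix[OF res]
  have "augmented_ranks d (Suc i) = 0"
  proof (rule minimal_matrix_resolution_vanishes[OF m(1,3)])
    show "augmented_ranks d 0 = augmented_ranks d' 0" by (simp add: augmented_ranks_def)
    show "(\<lambda>w. augmented_maps \<epsilon> \<phi> 0 *\<^sub>v w) ` carrier_vec (augmented_ranks d 1)
        = (\<lambda>w. augmented_maps \<epsilon>' \<phi>' 0 *\<^sub>v w) ` carrier_vec (augmented_ranks d' 1)"
      using m by simp
    show "lookup (p + q) 0 = lookup p 0 + lookup q 0" "lookup (p * q) 0 = lookup p 0 * lookup q 0"
      "lookup 1 0 = 1" for p q :: "('a, 'b) mpoly"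
      by (simp_all add: lookup_add lookup_mult_0)
    show "lookup (augmented_maps \<epsilon> \<phi> (Suc i) $$ (j, k)) 0 = 0"
      if "j < augmented_ranks d (Suc i)" "k < augmented_ranks d (Suc (Suc i))" for i j k
      using min that unfolding minimal_graded_free_resolution_def
      by (auto simp: augmented_ranks_def augmented_maps_def intro!: lookup_0_irrelevant_ideal)
    show "augmented_ranks d' (Suc i) = 0" using assms by (simp add: augmented_ranks_def)
  qed
  then show ?thesis by (simp add: augmented_ranks_def)
qed

lemma pd_eq_resolution_length:
  assumes min: "minimal_graded_free_resolution I \<epsilon> d \<phi>"
  shows "pd I = resolution_length d"
  unfolding pd_def
proof (rule the_equality)
  show "\<exists>\<epsilon> d' \<phi>. minimal_graded_free_resolution I \<epsilon> d' \<phi> \<and> resolution_length d = resolution_length d'"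
    using min by blast
next
  fix l assume "\<exists>\<epsilon> d \<phi>. minimal_graded_free_resolution I \<epsilon> d \<phi> \<and> l = resolution_length d"
  then obtain \<epsilon>' d' \<phi>' where m: "minimal_graded_free_resolution I \<epsilon>' d' \<phi>'" "l = resolution_length d'"
    by blast
  have "graded_free_resolution I \<epsilon> d \<phi>" "graded_free_resolution I \<epsilon>' d' \<phi>'"
    using min m by (simp_all add: minimal_graded_free_resolution_def)
  then have "d i = [] \<longleftrightarrow> d' i = []" for i
    using minimal_graded_free_resolution_vanishes min m(1) by blast
  then show "l = resolution_length d" by (simp add: m(2) resolution_length_def)
qed

lemma SUP_positive_degrees:
  "(SUP i\<in>{i. {b\<in>B. deg b = Suc i} \<noteq> {}}. enat i) = (SUP b\<in>{b\<in>B. deg b \<noteq> 0}. enat (deg b - 1))"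
proof -
  have "{i. {b\<in>B. deg b = Suc i} \<noteq> {}} = (\<lambda>b. deg b - 1) ` {b\<in>B. deg b \<noteq> 0}"
  proof (intro equalityI subsetI)
    fix i assume "i \<in> {i. {b\<in>B. deg b = Suc i} \<noteq> {}}"
    then obtain b where "b \<in> B" "deg b = Suc i" by auto
    then show "i \<in> (\<lambda>b. deg b - 1) ` {b\<in>B. deg b \<noteq> 0}" by (intro image_eqI[of _ _ b]) auto
  next
    fix i assume "i \<in> (\<lambda>b. deg b - 1) ` {b\<in>B. deg b \<noteq> 0}"
    then obtain b where "b \<in> B" "deg b = Suc i" by auto
    then show "i \<in> {i. {b\<in>B. deg b = Suc i} \<noteq> {}}" by auto
  qed
  then show ?thesis by (simp add: image_image)
qed

lemma pd_squarefree_resolution_minimal: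
  fixes D :: "'a \<Rightarrow> 'a \<Rightarrow>\<^sub>0 'k::field" and X :: "'n::finite set set"
  assumes "squarefree_resolution X r B deg L D" "abstract_simplicial_complex X"
    and "\<forall>b\<in>B. deg b \<ge> 2 \<longrightarrow> (\<forall>b'\<in>keys (D b). L b' \<noteq> L b)"
  shows "pd (stanley_reisner_ideal X :: ('n, 'k) mpoly set) = (SUP b\<in>{b\<in>B. deg b \<noteq> 0}. enat (deg b - 1))"
proof -
  interpret squarefree_resolution X r B deg L D by fact
  obtain \<epsilon> d \<phi> where d: "\<forall>i. d i = [] \<longleftrightarrow> {b\<in>B. deg b = Suc i} = {}"
    and m: "minimal_graded_free_resolution (stanley_reisner_ideal X :: ('n, 'k) mpoly set) \<epsilon> d \<phi>"
    using graded_free_resolution_exists assms(2,3) by blast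
  show ?thesis
    unfolding pd_eq_resolution_length[OF m] resolution_length_def
    using d SUP_positive_degrees[of B deg] by simp
qed

text \<open>The given resolution need not be minimal and so does not determine \<open>pd\<close>; a
  minimal one of the same ideal is supplied by the existence result and compared with it.\<close>

lemma pd_squarefree_resolution_le:
  fixes D :: "'a \<Rightarrow> 'a \<Rightarrow>\<^sub>0 'k::field" and X :: "'n::finite set set"
  assumes "squarefree_resolution X r B deg L D" and X: "abstract_simplicial_complex X"
  shows "pd (stanley_reisner_ideal X :: ('n, 'k) mpoly set) \<le> (SUP b\<in>{b\<in>B. deg b \<noteq> 0}. enat (deg b - 1))"
proof -
  interpret squarefree_resolution X r B deg L D by fact
  let ?I = "stanley_reisner_ideal X :: ('n, 'k) mpoly set"
  obtain \<epsilon> d \<phi> where res: "graded_free_resolution ?I \<epsilon> d \<phi>"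
    and d: "\<forall>i. d i = [] \<longleftrightarrow> {b\<in>B. deg b = Suc i} = {}"
    using graded_free_resolution_exists[OF X] by blast
  obtain B' L' and D' :: "nat \<times> nat \<Rightarrow> (nat \<times> nat) \<Rightarrow>\<^sub>0 'k"
    where res': "squarefree_resolution X (0, 0) B' fst L' D'"
      and min': "\<And>b b'. b \<in> B' \<Longrightarrow> fst b \<ge> 2 \<Longrightarrow> b' \<in> keys (D' b) \<Longrightarrow> L' b' \<noteq> L' b"
    using minimal_squarefree_resolution_exists[OF X] by metis
  interpret M: squarefree_resolution X "(0, 0)" B' fst L' D' by (rule res')
  obtain \<epsilon>' d' \<phi>' where m: "minimal_graded_free_resolution ?I \<epsilon>' d' \<phi>'"
    using M.graded_free_resolution_exists[OF X] min' by metis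
  have "resolution_length d' \<le> resolution_length d"
    unfolding resolution_length_def
    using minimal_graded_free_resolution_vanishes[OF m res] by (intro SUP_subset_mono) auto
  also have "\<dots> = (SUP b\<in>{b\<in>B. deg b \<noteq> 0}. enat (deg b - 1))"
    unfolding resolution_length_def using d SUP_positive_degrees[of B deg] by simp
  finally show ?thesis by (simp add: pd_eq_resolution_length[OF m])
qed

lemma pd_stanley_reisner_ideal:
  fixes X :: "'n::finite set set"
  assumes X: "abstract_simplicial_complex X"
  obtains B and L :: "nat \<times> nat \<Rightarrow> 'n set" and D :: "nat \<times> nat \<Rightarrow> (nat \<times> nat) \<Rightarrow>\<^sub>0 'k::field"
  where "squarefree_resolution X (0, 0) B fst L D"
    "pd (stanley_reisner_ideal X :: ('n, 'k) mpoly set) = (SUP b\<in>{b\<in>B. fst b \<noteq> 0}. enat (fst b - 1))"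
proof -
  obtain B L and D :: "nat \<times> nat \<Rightarrow> (nat \<times> nat) \<Rightarrow>\<^sub>0 'k"
    where res: "squarefree_resolution X (0, 0) B fst L D"
      and min: "\<And>b b'. b \<in> B \<Longrightarrow> fst b \<ge> 2 \<Longrightarrow> b' \<in> keys (D b) \<Longrightarrow> L b' \<noteq> L b"
    using minimal_squarefree_resolution_exists[OF X] by metis
  with pd_squarefree_resolution_minimal[OF res X] show ?thesis using that by blast
qed

section \<open>Intersections and sums of Stanley--Reisner ideals\<close>

lemma stanley_reisner_ideal_Int:
  assumes "abstract_simplicial_complex X" "abstract_simplicial_complex Y"
  shows "stanley_reisner_ideal X \<inter> stanley_reisner_ideal Y
    = (stanley_reisner_ideal (X \<union> Y) :: ('n::finite, 'k::field) mpoly set)"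
proof -
  have "abstract_simplicial_complex (X \<union> Y)"
    using assms unfolding abstract_simplicial_complex_def by blast
  then show ?thesis using assms by (auto simp: stanley_reisner_ideal_iff)
qed

lemma stanley_reisner_ideal_plus:
  assumes X: "abstract_simplicial_complex X" and Y: "abstract_simplicial_complex Y"
  shows "stanley_reisner_ideal X + stanley_reisner_ideal Y
    = (stanley_reisner_ideal (X \<inter> Y) :: ('n::finite, 'k::field) mpoly set)"
proof -
  have XY: "abstract_simplicial_complex (X \<inter> Y)"
    using assms unfolding abstract_simplicial_complex_def by blast
  show ?thesis
  proof (intro equalityI subsetI)
    fix p :: "('n, 'k) mpoly" assume "p \<in> stanley_reisner_ideal X + stanley_reisner_ideal Y"
    then obtain q s where "q \<in> stanley_reisner_ideal X" "s \<in> stanley_reisner_ideal Y" "p = q + s"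
      by (auto elim: set_plus_elim)
    then show "p \<in> stanley_reisner_ideal (X \<inter> Y)"
      using keys_add[of q s] X Y XY by (auto simp: stanley_reisner_ideal_iff)
  next
    fix p :: "('n, 'k) mpoly" assume "p \<in> stanley_reisner_ideal (X \<inter> Y)"
    then have p: "keys t \<notin> X \<inter> Y" if "t \<in> keys p" for t
      using that XY by (simp add: stanley_reisner_ideal_iff)
    \<comment> \<open>The terms of \<open>p\<close> are split by support: those outside
      \<open>X\<close> form \<open>q\<close>, and the remaining supports are faces of
      \<open>X\<close>, hence nonfaces of \<open>Y\<close>.\<close>
    define q where "q = (\<Sum>t\<in>{t\<in>keys p. keys t \<notin> X}. Poly_Mapping.single t (lookup p t))"
    define s where "s = (\<Sum>t\<in>{t\<in>keys p. keys t \<in> X}. Poly_Mapping.single t (lookup p t))"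
    have "keys q \<subseteq> {t\<in>keys p. keys t \<notin> X}" "keys s \<subseteq> {t\<in>keys p. keys t \<in> X}"
      unfolding q_def s_def by (auto simp: in_keys_iff lookup_sum lookup_single when_def split: if_splits)
    then have "q \<in> stanley_reisner_ideal X" "s \<in> stanley_reisner_ideal Y"
      using p X Y by (auto simp: stanley_reisner_ideal_iff)
    moreover have "q + s = (\<Sum>t\<in>{t\<in>keys p. keys t \<notin> X} \<union> {t\<in>keys p. keys t \<in> X}.
        Poly_Mapping.single t (lookup p t))"
      unfolding q_def s_def by (rule sum.union_disjoint[symmetric]) auto
    moreover have "{t\<in>keys p. keys t \<notin> X} \<union> {t\<in>keys p. keys t \<in> X} = keys p" by blast
    ultimately show "p \<in> stanley_reisner_ideal X + stanley_reisner_ideal Y"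
      using set_plus_intro[of q _ s] by (simp add: sum_monomials)
  qed
qed

theorem theorem1p5:
  fixes X Y :: "'n::finite set set"
    and I_X I_Y :: "('n, 'k::field) mpoly set"
  assumes "abstract_simplicial_complex X"
    and "abstract_simplicial_complex Y"
    and "I_X = stanley_reisner_ideal X"
    and "I_Y = stanley_reisner_ideal Y"
  shows "pd (I_X \<inter> I_Y) \<le> pd I_X + pd I_Y \<and> pd (I_X + I_Y) \<le> pd I_X + pd I_Y + 1"
proof -
  obtain B L and D :: "nat \<times> nat \<Rightarrow> (nat \<times> nat) \<Rightarrow>\<^sub>0 'k"
    where F: "squarefree_resolution X (0, 0) B fst L D"
      and pd_X: "pd I_X = (SUP b\<in>{b\<in>B. fst b \<noteq> 0}. enat (fst b - 1))"
    unfolding assms(3) by (rule pd_stanley_reisner_ideal[OF assms(1)])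
  obtain C M and E :: "nat \<times> nat \<Rightarrow> (nat \<times> nat) \<Rightarrow>\<^sub>0 'k"
    where G: "squarefree_resolution Y (0, 0) C fst M E"
      and pd_Y: "pd I_Y = (SUP c\<in>{c\<in>C. fst c \<noteq> 0}. enat (fst c - 1))"
    unfolding assms(4) by (rule pd_stanley_reisner_ideal[OF assms(2)])
  have le_X: "enat (fst b - 1) \<le> pd I_X" if "b \<in> B" "fst b \<noteq> 0" for b
    unfolding pd_X using that by (intro SUP_upper) auto
  have le_Y: "enat (fst c - 1) \<le> pd I_Y" if "c \<in> C" "fst c \<noteq> 0" for c
    unfolding pd_Y using that by (intro SUP_upper) auto
  have le: "enat ((fst b - 1) + (fst c - 1)) \<le> pd I_X + pd I_Y"
    if "b \<in> B" "fst b \<noteq> 0" "c \<in> C" "fst c \<noteq> 0" for b c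
    using add_mono[OF le_X[of b] le_Y[of c]] that by simp
  have complexes: "abstract_simplicial_complex (X \<union> Y)" "abstract_simplicial_complex (X \<inter> Y)"
    using assms(1,2) unfolding abstract_simplicial_complex_def by blast+
  let ?P = "insert ((0, 0), (0, 0)) {x\<in>B \<times> C. fst (fst x) \<noteq> 0 \<and> fst (snd x) \<noteq> 0}"
  obtain T :: "(nat \<times> nat) \<times> (nat \<times> nat) \<Rightarrow> ((nat \<times> nat) \<times> (nat \<times> nat)) \<Rightarrow>\<^sub>0 'k"
    where T: "squarefree_resolution (X \<union> Y) ((0, 0), (0, 0)) ?P
      (\<lambda>x. fst (fst x) + fst (snd x) - 1) (\<lambda>x. L (fst x) \<union> M (snd x)) T"
    by (rule squarefree_resolution_tensor_pos[OF F G])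
  have "pd (I_X \<inter> I_Y)
      \<le> (SUP x\<in>{x\<in>?P. fst (fst x) + fst (snd x) - 1 \<noteq> 0}. enat (fst (fst x) + fst (snd x) - 1 - 1))"
    unfolding assms(3,4) stanley_reisner_ideal_Int[OF assms(1,2)]
    by (rule pd_squarefree_resolution_le[OF T complexes(1)])
  also have "\<dots> \<le> pd I_X + pd I_Y"
  proof (rule SUP_least)
    fix x assume "x \<in> {x\<in>?P. fst (fst x) + fst (snd x) - 1 \<noteq> 0}"
    \<comment> \<open>The root has degree 0 and is absent from this supremum, so both homological
      degrees are positive and each can be lowered by 1.\<close>
    then have x: "fst x \<in> B" "snd x \<in> C" "fst (fst x) \<noteq> 0" "fst (snd x) \<noteq> 0" by auto
    then have "fst (fst x) + fst (snd x) - 1 - 1 = (fst (fst x) - 1) + (fst (snd x) - 1)" by linarith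
    then show "enat (fst (fst x) + fst (snd x) - 1 - 1) \<le> pd I_X + pd I_Y"
      using le[OF x(1,3,2,4)] by simp
  qed
  finally have cap: "pd (I_X \<inter> I_Y) \<le> pd I_X + pd I_Y" .
  have "pd (I_X + I_Y)
      \<le> (SUP x\<in>{x\<in>B \<times> C. fst (fst x) + fst (snd x) \<noteq> 0}. enat (fst (fst x) + fst (snd x) - 1))"
    unfolding assms(3,4) stanley_reisner_ideal_plus[OF assms(1,2)]
    by (rule pd_squarefree_resolution_le[OF squarefree_resolution_tensor[OF F G] complexes(2)])
  also have "\<dots> \<le> pd I_X + pd I_Y + 1"
  proof (rule SUP_least)
    fix x assume "x \<in> {x\<in>B \<times> C. fst (fst x) + fst (snd x) \<noteq> 0}"
    then have x: "fst x \<in> B" "snd x \<in> C" "fst (fst x) + fst (snd x) \<noteq> 0" by auto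
    \<comment> \<open>The bound \<open>le\<close> covers two positive degrees only. If one factor is
      the root, the whole degree comes from the other and is bounded by its \<open>pd\<close>. The
      extra 1 is spent in the third case, where the product is lowered once and the factors
      twice.\<close>
    then consider "fst (fst x) = 0" "fst (snd x) \<noteq> 0" | "fst (fst x) \<noteq> 0" "fst (snd x) = 0"
      | "fst (fst x) \<noteq> 0" "fst (snd x) \<noteq> 0" by auto
    then show "enat (fst (fst x) + fst (snd x) - 1) \<le> pd I_X + pd I_Y + 1"
    proof cases
      case 1
      then have "enat (fst (fst x) + fst (snd x) - 1) \<le> pd I_Y" using le_Y[OF x(2)] by simp
      also have "\<dots> \<le> pd I_X + pd I_Y + 1" by (simp add: add_increasing add_increasing2)
      finally show ?thesis .
    next
      case 2
      then have "enat (fst (fst x) + fst (snd x) - 1) \<le> pd I_X" using le_X[OF x(1)] by simp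
      also have "\<dots> \<le> pd I_X + pd I_Y + 1" by (simp add: add_increasing add_increasing2 add.assoc)
      finally show ?thesis .
    next
      case 3
      then have "fst (fst x) + fst (snd x) - 1 = (fst (fst x) - 1) + (fst (snd x) - 1) + 1" by linarith
      from arg_cong[OF this, of enat] have "enat (fst (fst x) + fst (snd x) - 1) = enat ((fst (fst x) - 1) + (fst (snd x) - 1)) + 1"
        by (simp only: one_enat_def plus_enat_simps)
      also have "\<dots> \<le> pd I_X + pd I_Y + 1"
        using le[OF x(1) 3(1) x(2) 3(2)] by (intro add_right_mono)
      finally show ?thesis .
    qed
  qed
  finally show ?thesis using cap by blast
qed

end
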